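(* For every homeomorphism $\eta:[0,+\infty)\to[0,+\infty)$ there is a constant $K=K(\eta)\ge 1$, depending only on $\eta$, such that every $\eta$-quasisymmetric embedding $f:\mathbb{Z}\to\mathbb{R}$ admits a $K$-quasiconformal extension, i.e. there is a $K$-quasiconformal mapping $F:\mathbb{C}\to\mathbb{C}$ with $F(n)=f(n)$ for all $n\in\mathbb{Z}$.
   Context: Here $\mathbb{Z}\subset\mathbb{R}\subset\mathbb{C}$. Let $\eta:[0,+\infty)\to[0,+\infty)$ be a homeomorphism and $X\subset\mathbb{C}$. An injection $f:X\to\mathbb{C}$ is $\eta$-quasisymmetric if $\left|\frac{f(x)-f(y)}{f(x)-f(z)}\right|\le\eta\left(\left|\frac{x-y}{x-z}\right|\right)$ for all $x,y,z\in X$ with $x\ne z$. An $\eta$-quasisymmetric embedding $\mathbb{Z}\to\mathbb{R}$ is such an injection with $X=\mathbb{Z}$ and values in $\mathbb{R}$ (it need not be monotone). For $K\ge1$ and a domain $\Omega\subset\mathbb{C}$, an orientation preserving homeomorphism $F$ of $\Omega$ into $\mathbb{C}$ is $K$-quasiconformal if its distributional derivatives $F_z,F_{\bar z}$ are locally integrable and $\operatorname{ess\,sup}_{z\in\Omega}\frac{|F_z(z)|+|F_{\bar z}(z)|}{|F_z(z)|-|F_{\bar z}(z)|}\le K$. *)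

theory Defs
  imports "HOL-Complex_Analysis.Complex_Analysis" "HOL-Probability.Essential_Supremum"
begin

definition quasisymmetric_on :: "(real \<Rightarrow> real) \<Rightarrow> complex set \<Rightarrow> (complex \<Rightarrow> complex) \<Rightarrow> bool" where
  "quasisymmetric_on \<eta> X f \<longleftrightarrow>
     inj_on f X \<and>
     (\<forall>x\<in>X. \<forall>y\<in>X. \<forall>z\<in>X. x \<noteq> z \<longrightarrow>
        cmod ((f x - f y) / (f x - f z)) \<le> \<eta> (cmod ((x - y) / (x - z))))"

text \<open>Smoothness is meant over the reals: all iterated directional derivatives are
  Frechet differentiable.\<close>

primrec Ck_real :: "nat \<Rightarrow> (complex \<Rightarrow> complex) \<Rightarrow> bool" where
  "Ck_real 0 \<phi> \<longleftrightarrow> continuous_on UNIV \<phi>"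
| "Ck_real (Suc k) \<phi> \<longleftrightarrow>
     (\<forall>z. \<phi> differentiable (at z)) \<and>
     (\<forall>v. Ck_real k (\<lambda>z. frechet_derivative \<phi> (at z) v))"

definition test_function_on :: "complex set \<Rightarrow> (complex \<Rightarrow> complex) \<Rightarrow> bool" where
  "test_function_on \<Omega> \<phi> \<longleftrightarrow>
     (\<forall>k. Ck_real k \<phi>) \<and>
     compact (closure {z. \<phi> z \<noteq> 0}) \<and> closure {z. \<phi> z \<noteq> 0} \<subseteq> \<Omega>"

definition d_z :: "(complex \<Rightarrow> complex) \<Rightarrow> complex \<Rightarrow> complex" where
  "d_z \<phi> z = (frechet_derivative \<phi> (at z) 1 - \<i> * frechet_derivative \<phi> (at z) \<i>) / 2"

definition d_zbar :: "(complex \<Rightarrow> complex) \<Rightarrow> complex \<Rightarrow> complex" where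
  "d_zbar \<phi> z = (frechet_derivative \<phi> (at z) 1 + \<i> * frechet_derivative \<phi> (at z) \<i>) / 2"

definition locally_integrable_on :: "(complex \<Rightarrow> complex) \<Rightarrow> complex set \<Rightarrow> bool" where
  "locally_integrable_on g \<Omega> \<longleftrightarrow>
     (\<forall>C. compact C \<and> C \<subseteq> \<Omega> \<longrightarrow> g absolutely_integrable_on C)"

definition distributional_d_z ::
    "complex set \<Rightarrow> (complex \<Rightarrow> complex) \<Rightarrow> (complex \<Rightarrow> complex) \<Rightarrow> bool" where
  "distributional_d_z \<Omega> F p \<longleftrightarrow>
     (\<forall>\<phi>. test_function_on \<Omega> \<phi> \<longrightarrow>
        (LINT z|lebesgue_on \<Omega>. F z * d_z \<phi> z) = - (LINT z|lebesgue_on \<Omega>. p z * \<phi> z))"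

definition distributional_d_zbar ::
    "complex set \<Rightarrow> (complex \<Rightarrow> complex) \<Rightarrow> (complex \<Rightarrow> complex) \<Rightarrow> bool" where
  "distributional_d_zbar \<Omega> F q \<longleftrightarrow>
     (\<forall>\<phi>. test_function_on \<Omega> \<phi> \<longrightarrow>
        (LINT z|lebesgue_on \<Omega>. F z * d_zbar \<phi> z) = - (LINT z|lebesgue_on \<Omega>. q z * \<phi> z))"

text \<open>A planar embedding has local degree 1 or -1 at each point; the degree at \<open>z\<close> is the
  winding number about \<open>F z\<close> of the image of a small positively oriented circle about \<open>z\<close>.\<close>

definition orientation_preserving_on :: "complex set \<Rightarrow> (complex \<Rightarrow> complex) \<Rightarrow> bool" where
  "orientation_preserving_on \<Omega> F \<longleftrightarrow>
     (\<forall>z r. r > 0 \<and> cball z r \<subseteq> \<Omega> \<longrightarrow> winding_number (F \<circ> circlepath z r) (F z) = 1)"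

text \<open>The quotient is taken in the extended reals, where \<open>a / 0 = \<infinity>\<close> for \<open>a > 0\<close>
  (whereas \<open>a / 0 = 0\<close> in the reals) and \<open>0 / 0 = 0\<close>.\<close>

definition quasiconformal_on :: "real \<Rightarrow> complex set \<Rightarrow> (complex \<Rightarrow> complex) \<Rightarrow> bool" where
  "quasiconformal_on K \<Omega> F \<longleftrightarrow>
     1 \<le> K \<and> open \<Omega> \<and> connected \<Omega> \<and> \<Omega> \<noteq> {} \<and>
     (\<exists>G. homeomorphism \<Omega> (F ` \<Omega>) F G) \<and>
     orientation_preserving_on \<Omega> F \<and>
     (\<exists>p q. locally_integrable_on p \<Omega> \<and> distributional_d_z \<Omega> F p \<and>
            locally_integrable_on q \<Omega> \<and> distributional_d_zbar \<Omega> F q \<and>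
            esssup (lebesgue_on \<Omega>)
              (\<lambda>z. ereal (cmod (p z) + cmod (q z)) / ereal (cmod (p z) - cmod (q z)))
              \<le> ereal K)"

end

(*
  Large steps of a quasisymmetric f : Z -> R dominate single steps, so f is monotone at distances
  >= M = M(eta); composing with -1 it may be taken increasing there. The piecewise linear
  density with values (f(n+M) - f(n))/M at n integrates to a C^1 homeomorphism G of R, which takes
  at n an average of f(n), ..., f(n+M) and is doubling, so its Beurling-Ahlfors extension is a
  quasiconformal C^1 map. Moreover f = G o sigma on Z, where sigma : Z -> R moves points by at
  most D and has separation bounded below in terms of eta, but need not be monotone.
  The map sigma extends by shears: lift n to the height N (n mod N) with N much larger than D,
  which makes the points N-separated, shift them horizontally to sigma(n), and drop them again.
  All maps are C^1, so the chain rule controls the dilatation of the composition pointwise.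
*)

theory Submission
  imports Defs
begin

section \<open>C1 quasiconformal maps\<close>

text \<open>A quasisymmetric sequence may swap neighbouring integers, and a homeomorphism of the
  plane that preserves the real line is monotone on it. So an extension cannot preserve the line in
  general, and the Beurling-Ahlfors formula cannot be applied to f itself. The large-scale order
  goes into G and the disorder into sigma, where it has bounded size and is resolved by means of the
  second dimension. What makes this work is that near n all increments of f over bounded distances
  are comparable in absolute value to f(n+M) - f(n), with constants depending on eta only. This
  gives the separation of sigma and the doubling of G at small scales; at large scales G inherits
  doubling from f. The maps are kept C^1 with positive Jacobian because composing general
  quasiconformal maps needs their analytic theory. For C^1 maps the distributional derivatives are
  the classical ones, and the local degree can be read off the linearization.\<close>

definition jac_det :: "(complex \<Rightarrow> complex) \<Rightarrow> real" where
  "jac_det L = Im (cnj (L 1) * L \<i>)"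

text \<open>The Hilbert-Schmidt norm replaces the operator norm because it is polynomial in the
  entries and still submultiplicative. The price is a factor: \<open>hs_norm2 L\<close> is at least
  \<open>2 * jac_det L\<close>, with equality for conformal \<open>L\<close>, so
  \<open>C1_qc K\<close> can only hold for \<open>K\<close> at least 2.\<close>

definition hs_norm2 :: "(complex \<Rightarrow> complex) \<Rightarrow> real" where
  "hs_norm2 L = (cmod (L 1))\<^sup>2 + (cmod (L \<i>))\<^sup>2"

text \<open>For \<open>L v = p v + q (cnj v)\<close> one has \<open>jac_det L = \<bar>p\<bar>\<^sup>2 - \<bar>q\<bar>\<^sup>2\<close> and
  \<open>hs_norm2 L = 2 (\<bar>p\<bar>\<^sup>2 + \<bar>q\<bar>\<^sup>2) \<ge> (\<bar>p\<bar> + \<bar>q\<bar>)\<^sup>2\<close>, so the condition below bounds the dilatation by \<open>K\<close>.\<close>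

definition C1_qc :: "real \<Rightarrow> (complex \<Rightarrow> complex) \<Rightarrow> bool" where
  "C1_qc K F \<longleftrightarrow> inj F \<and>
     (\<exists>F'. (\<forall>z. (F has_derivative F' z) (at z)) \<and> (\<forall>v. continuous_on UNIV (\<lambda>z. F' z v)) \<and>
           (\<forall>z. 0 < jac_det (F' z) \<and> hs_norm2 (F' z) \<le> K * jac_det (F' z)))"

section \<open>Real-linear maps of the plane and composition\<close>

lemma real_linear_complex:
  assumes "bounded_linear L"
  shows "L v = Re v *\<^sub>R L 1 + Im v *\<^sub>R L \<i>"
proof -
  interpret bounded_linear L by fact
  have "L v = L (Re v *\<^sub>R 1 + Im v *\<^sub>R \<i>)"
    by (metis complex_eq scaleR_conv_of_real mult.commute mult.right_neutral)
  then show ?thesis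
    by (simp only: add scaleR)
qed

lemma hs_norm2_comp_le:
  assumes "bounded_linear L"
  shows "hs_norm2 (L \<circ> M) \<le> hs_norm2 L * hs_norm2 M"
proof -
  have *: "(cmod (L v))\<^sup>2 \<le> hs_norm2 L * (cmod v)\<^sup>2" for v
  proof -
    have "cmod (L v) \<le> \<bar>Re v\<bar> * cmod (L 1) + \<bar>Im v\<bar> * cmod (L \<i>)"
      by (subst real_linear_complex[OF assms]) (metis norm_scaleR norm_triangle_ineq)
    then have "(cmod (L v))\<^sup>2 \<le> (\<bar>Re v\<bar> * cmod (L 1) + \<bar>Im v\<bar> * cmod (L \<i>))\<^sup>2"
      by (intro power_mono) auto
    also have "\<dots> \<le> ((cmod (L 1))\<^sup>2 + (cmod (L \<i>))\<^sup>2) * (\<bar>Re v\<bar>\<^sup>2 + \<bar>Im v\<bar>\<^sup>2)"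
      \<comment> \<open>Cauchy-Schwarz: the two sides differ by exactly this square.\<close>
      using zero_le_power2[of "\<bar>Re v\<bar> * cmod (L \<i>) - \<bar>Im v\<bar> * cmod (L 1)"]
      by (simp only: power2_eq_square algebra_simps)
    finally show ?thesis by (simp add: hs_norm2_def cmod_power2)
  qed
  show ?thesis
    using *[of "M 1"] *[of "M \<i>"] by (simp add: hs_norm2_def algebra_simps)
qed

lemma jac_det_comp:
  assumes "bounded_linear L"
  shows "jac_det (L \<circ> M) = jac_det L * jac_det M"
  by (simp add: jac_det_def real_linear_complex[OF assms, of "M _"] algebra_simps)

lemma C1_qc_comp:
  assumes "C1_qc K F" "C1_qc K' G"
  shows "C1_qc (K * K') (F \<circ> G)"
proof -
  obtain F' where F: "inj F" "\<And>z. (F has_derivative F' z) (at z)"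
      "\<And>v. continuous_on UNIV (\<lambda>z. F' z v)"
      "\<And>z. 0 < jac_det (F' z)" "\<And>z. hs_norm2 (F' z) \<le> K * jac_det (F' z)"
    using assms(1) unfolding C1_qc_def by blast
  obtain G' where G: "inj G" "\<And>z. (G has_derivative G' z) (at z)"
      "\<And>v. continuous_on UNIV (\<lambda>z. G' z v)"
      "\<And>z. 0 < jac_det (G' z)" "\<And>z. hs_norm2 (G' z) \<le> K' * jac_det (G' z)"
    using assms(2) unfolding C1_qc_def by blast
  have bl: "bounded_linear (F' z)" for z using F(2) has_derivative_bounded_linear by blast
  have contG: "continuous_on UNIV G"
    by (intro continuous_at_imp_continuous_on ballI has_derivative_continuous[OF G(2)])
  let ?D = "\<lambda>z. F' (G z) \<circ> G' z"
  have "(F \<circ> G has_derivative ?D z) (at z)" for z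
    by (rule diff_chain_at[OF G(2) F(2)])
  moreover have "continuous_on UNIV (\<lambda>z. ?D z v)" for v
  proof -
    have "continuous_on UNIV (\<lambda>z. F' (G z) u)" for u
      using continuous_on_compose2[OF F(3) contG, of u] by simp
    \<comment> \<open>The derivatives are only known to be continuous in each fixed direction,
      whereas here the direction \<open>G' z v\<close> moves with \<open>z\<close>. Expanding it in
      the basis 1, \<open>\<i>\<close> separates the two dependences.\<close>
    then have "continuous_on UNIV (\<lambda>z. Re (G' z v) *\<^sub>R F' (G z) 1 + Im (G' z v) *\<^sub>R F' (G z) \<i>)"
      by (intro continuous_intros G(3))
    then show ?thesis
      unfolding o_def by (subst real_linear_complex[OF bl])
  qed
  moreover have "0 < jac_det (?D z)" for z
    by (simp add: jac_det_comp[OF bl] F(4) G(4))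
  moreover have "hs_norm2 (?D z) \<le> K * K' * jac_det (?D z)" for z
  proof -
    have "hs_norm2 (?D z) \<le> hs_norm2 (F' (G z)) * hs_norm2 (G' z)"
      by (rule hs_norm2_comp_le[OF bl])
    also have "\<dots> \<le> (K * jac_det (F' (G z))) * (K' * jac_det (G' z))"
      using F(5)[of "G z"] G(5)[of z]
      by (intro mult_mono) (auto simp: hs_norm2_def intro: order_trans[rotated])
    finally show ?thesis by (simp add: jac_det_comp[OF bl] mult_ac)
  qed
  ultimately show ?thesis
    unfolding C1_qc_def using inj_compose[OF F(1) G(1)]
    by (intro conjI exI[of _ ?D]) blast+
qed

text \<open>In the plane negation is the rotation by pi, hence orientation preserving; this reduces
  decreasing sequences to increasing ones. The 2 is \<open>hs_norm2\<close> of an isometry.\<close>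

lemma C1_qc_uminus: "C1_qc 2 uminus"
  unfolding C1_qc_def
  by (intro conjI exI[of _ "\<lambda>_. uminus"])
     (auto simp: jac_det_def hs_norm2_def bounded_linear_minus[OF bounded_linear_ident]
       intro!: derivative_eq_intros continuous_intros)

section \<open>Distributional derivatives of C^1 maps\<close>

text \<open>Difference quotients have integral 0 by translation invariance, and they converge
  dominatedly.\<close>

lemma integral_directional_derivative_eq_0:
  fixes \<psi> :: "'a::euclidean_space \<Rightarrow> 'b::euclidean_space"
  assumes D: "\<And>z. (\<psi> has_derivative D z) (at z)"
    and cont: "continuous_on UNIV (\<lambda>z. D z v)"
    and C: "compact C" "\<And>z. z \<notin> C \<Longrightarrow> \<psi> z = 0"
  shows "integral\<^sup>L lborel (\<lambda>z. D z v) = 0"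
proof -
  obtain R where R: "\<And>z. z \<in> C \<Longrightarrow> norm z \<le> R"
    using compact_imp_bounded[OF C(1)] by (auto simp: bounded_iff)
  have \<psi>0: "\<psi> z = 0" if "norm z > R" for z
    using C(2) R that by fastforce
  have D0: "D z v = 0" if "norm z > R" for z
  proof -
    have "open {z::'a. norm z > R}"
      by (intro open_Collect_less continuous_intros)
    then have "((\<lambda>_. 0) has_derivative D z) (at z)"
      by (rule has_derivative_transform_within_open[OF D]) (use that \<psi>0 in auto)
    then have "D z = (\<lambda>_. 0)"
      by (rule has_derivative_unique) (rule has_derivative_const)
    then show ?thesis by simp
  qed
  have "bounded ((\<lambda>z. D z v) ` cball 0 R)"
    by (intro compact_imp_bounded compact_continuous_image continuous_on_subset[OF cont]) auto
  then obtain M0 where "\<forall>z\<in>cball 0 R. norm (D z v) \<le> M0"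
    unfolding bounded_iff by blast
  then have M0: "norm (D z v) \<le> M0" if "norm z \<le> R" for z
    using that by simp
  \<comment> \<open>\<open>R\<close> may be negative; then the ball is empty and \<open>M0\<close>
    arbitrary. The maximum keeps the bound valid where the derivative vanishes.\<close>
  define M where "M = max M0 0"
  have M: "norm (D z v) \<le> M" for z
    using M0[of z] D0[of z] by (cases "norm z \<le> R") (auto simp: M_def)
  have vd: "((\<lambda>s. \<psi> (z + s *\<^sub>R v)) has_vector_derivative D (z + s *\<^sub>R v) v) (at s)" for z s
  proof -
    have "((\<lambda>s. z + s *\<^sub>R v) has_derivative (\<lambda>h. h *\<^sub>R v)) (at s)"
      by (auto intro!: derivative_eq_intros)
    then have "((\<lambda>s. \<psi> (z + s *\<^sub>R v)) has_derivative (\<lambda>h. D (z + s *\<^sub>R v) (h *\<^sub>R v))) (at s)"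
      by (rule has_derivative_compose[OF _ D])
    moreover have "D (z + s *\<^sub>R v) (h *\<^sub>R v) = h *\<^sub>R D (z + s *\<^sub>R v) v" for h
      using has_derivative_bounded_linear[OF D] by (simp add: linear_simps)
    ultimately show ?thesis by (simp add: has_vector_derivative_def)
  qed
  have contpsi: "continuous_on UNIV \<psi>"
    by (intro continuous_at_imp_continuous_on ballI has_derivative_continuous[OF D])
  have meas[measurable]: "\<psi> \<in> borel_measurable borel" "(\<lambda>z. D z v) \<in> borel_measurable borel"
    using contpsi cont by (auto intro: borel_measurable_continuous_onI)
  define t where "t n = 1 / real (Suc n)" for n
  have t: "0 < t n" "t n \<le> 1" for n by (auto simp: t_def)
  define f where "f n = (\<lambda>z. (\<psi> (z + t n *\<^sub>R v) - \<psi> z) /\<^sub>R t n)" for n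
  \<comment> \<open>Since \<open>t n\<close> is at most 1, every difference quotient vanishes
    outside this ball, which gives an integrable majorant.\<close>
  let ?B = "cball 0 (R + norm v) :: 'a set"
  have f0: "integral\<^sup>L lborel (f n) = 0" for n
  proof -
    have i: "integrable lborel \<psi>"
    proof -
      have "integrable lborel (\<lambda>x. indicator C x *\<^sub>R \<psi> x)"
        by (intro borel_integrable_compact C continuous_on_subset[OF contpsi]) auto
      moreover have "indicator C x *\<^sub>R \<psi> x = \<psi> x" for x
        using C(2) by (auto simp: indicator_def)
      ultimately show ?thesis by simp
    qed
    have eq: "integral\<^sup>L lborel \<psi> = integral\<^sup>L lborel (\<lambda>z. \<psi> (c + z))" for c
      by (subst lborel_distr_plus[of c, symmetric], subst integral_distr) auto
    have i2: "integrable lborel (\<lambda>z. \<psi> (c + z))" for c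
    proof -
      have "integrable (distr lborel borel ((+) c)) \<psi>" using i by (simp add: lborel_distr_plus)
      then show ?thesis by (subst (asm) integrable_distr_eq) auto
    qed
    show ?thesis
      using eq[of "t n *\<^sub>R v"] i i2[of "t n *\<^sub>R v"] by (simp add: f_def add.commute)
  qed
  have bound: "norm (f n z) \<le> indicat_real ?B z * M" for n z
  proof (cases "z \<in> ?B")
    case True
    have "norm (\<psi> (z + t n *\<^sub>R v) - \<psi> (z + 0 *\<^sub>R v)) \<le> M * norm (t n - 0)"
    proof (rule differentiable_bound[where S = "{0..t n}"])
      fix s
      show "((\<lambda>s. \<psi> (z + s *\<^sub>R v)) has_derivative (\<lambda>h. h *\<^sub>R D (z + s *\<^sub>R v) v)) (at s within {0..t n})"
        using vd[of z s] unfolding has_vector_derivative_def by (rule has_derivative_at_withinI)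
      show "onorm (\<lambda>h. h *\<^sub>R D (z + s *\<^sub>R v) v) \<le> M"
        by (rule onorm_le) (use M[of "z + s *\<^sub>R v"] in \<open>simp add: mult.commute[of M] mult_left_mono\<close>)
    qed (use t[of n] in auto)
    then show ?thesis using t[of n] True
      by (simp add: f_def divide_simps mult.commute)
  next
    case False
    then have "norm z > R + norm v" by auto
    moreover have "norm (t n *\<^sub>R v) \<le> norm v" using t[of n] by (simp add: mult_left_le_one_le)
    moreover have "norm z \<le> norm (z + t n *\<^sub>R v) + norm (t n *\<^sub>R v)"
      using norm_triangle_ineq4[of "z + t n *\<^sub>R v" "t n *\<^sub>R v"] by simp
    ultimately have "norm z > R" "norm (z + t n *\<^sub>R v) > R" by (smt (verit) norm_ge_zero)+
    then show ?thesis by (simp add: f_def \<psi>0 M_def)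
  qed
  have "(\<lambda>n. integral\<^sup>L lborel (f n)) \<longlonglongrightarrow> integral\<^sup>L lborel (\<lambda>z. D z v)"
  proof (rule integral_dominated_convergence)
    show "(\<lambda>z. D z v) \<in> borel_measurable lborel" "\<And>n. f n \<in> borel_measurable lborel"
      unfolding f_def by measurable
    have "integrable lborel (\<lambda>z::'a. indicat_real ?B z *\<^sub>R M)"
      by (rule borel_integrable_compact) auto
    then show "integrable lborel (\<lambda>z. indicat_real ?B z * M)" by simp
    show "AE z in lborel. norm (f n z) \<le> indicat_real ?B z * M" for n
      using bound by simp
    show "AE z in lborel. (\<lambda>n. f n z) \<longlonglongrightarrow> D z v"
    proof (rule AE_I2)
      fix z
      have "((\<lambda>s. (\<psi> (z + s *\<^sub>R v) - \<psi> z) /\<^sub>R s) \<longlongrightarrow> D z v) (at 0)"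
      proof (rule Lim_transform_eventually)
        let ?q = "\<lambda>s. (\<psi> (z + s *\<^sub>R v) - \<psi> z - s *\<^sub>R D z v) /\<^sub>R s"
        have "((\<lambda>s. norm (\<psi> (z + s *\<^sub>R v) - \<psi> z - s *\<^sub>R D z v) / norm s) \<longlongrightarrow> 0) (at 0)"
          using vd[of z 0] by (simp add: has_vector_derivative_def has_derivative_at)
        then have "((\<lambda>s. norm (?q s)) \<longlongrightarrow> 0) (at 0)"
          by (simp add: divide_inverse mult.commute)
        then have "(?q \<longlongrightarrow> 0) (at 0)"
          by (rule tendsto_norm_zero_cancel)
        then show "((\<lambda>s. ?q s + D z v) \<longlongrightarrow> D z v) (at 0)"
          by (rule tendsto_eq_intros) (auto intro: tendsto_const)
        show "\<forall>\<^sub>F s in at 0. ?q s + D z v = (\<psi> (z + s *\<^sub>R v) - \<psi> z) /\<^sub>R s"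
          unfolding eventually_at_filter by (simp add: scaleR_diff_right)
      qed
      moreover have "filterlim t (at 0) sequentially"
        using LIMSEQ_inverse_real_of_nat t
        by (auto simp: filterlim_at t_def[abs_def] inverse_eq_divide)
      ultimately show "(\<lambda>n. f n z) \<longlonglongrightarrow> D z v"
        unfolding f_def by (rule filterlim_compose)
    qed
  qed
  then show ?thesis by (simp add: f0 LIMSEQ_const_iff)
qed

lemma lebesgue_integral_eq_lborel:
  fixes f :: "complex \<Rightarrow> complex"
  assumes "continuous_on UNIV f"
  shows "integral\<^sup>L (lebesgue_on UNIV) f = integral\<^sup>L lborel f"
  using integral_completion[of f lborel] borel_measurable_continuous_onI[OF assms]
  by (simp add: lebesgue_on_UNIV_eq)

text \<open>The product of \<open>F\<close> and \<open>\<phi>\<close> has compact support, so its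
  directional derivative has integral 0, and the Leibniz rule splits that integral. The directions 1
  and \<open>\<i>\<close> are later combined into \<open>d_z\<close> and \<open>d_zbar\<close>,
  which is why integrability and continuity of both terms are exported.\<close>

lemma integral_by_parts_test_function:
  fixes F \<phi> :: "complex \<Rightarrow> complex"
  assumes F: "\<And>z. (F has_derivative F' z) (at z)" "continuous_on UNIV (\<lambda>z. F' z v)"
    and \<phi>: "test_function_on UNIV \<phi>"
  defines "D \<equiv> \<lambda>z. frechet_derivative \<phi> (at z) v"
  shows "integral\<^sup>L lborel (\<lambda>z. F z * D z) = - integral\<^sup>L lborel (\<lambda>z. F' z v * \<phi> z)"
    and "integrable lborel (\<lambda>z. F z * D z)" "integrable lborel (\<lambda>z. F' z v * \<phi> z)"
    and "continuous_on UNIV (\<lambda>z. F z * D z)" "continuous_on UNIV (\<lambda>z. F' z v * \<phi> z)"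
proof -
  have ck: "Ck_real k \<phi>" for k using \<phi> by (simp add: test_function_on_def)
  have d\<phi>: "(\<phi> has_derivative frechet_derivative \<phi> (at z)) (at z)" for z
    using ck[of "Suc 0"] by (simp add: frechet_derivative_works)
  have cD: "continuous_on UNIV D"
    using ck[of "Suc 0"] unfolding D_def by simp
  have c\<phi>: "continuous_on UNIV \<phi>"
    using ck[of 0] by simp
  have cF: "continuous_on UNIV F"
    by (intro continuous_at_imp_continuous_on ballI has_derivative_continuous[OF F(1)])
  define C where "C = closure {z. \<phi> z \<noteq> 0}"
  have C: "compact C" using \<phi> by (simp add: test_function_on_def C_def)
  have \<phi>0: "\<phi> z = 0" if "z \<notin> C" for z
    using that closure_subset[of "{z. \<phi> z \<noteq> 0}"] by (auto simp: C_def)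
  have D0: "D z = 0" if "z \<notin> C" for z
  proof -
    have "open (- C)" using C compact_imp_closed by blast
    then have "((\<lambda>_. 0) has_derivative frechet_derivative \<phi> (at z)) (at z)"
      by (rule has_derivative_transform_within_open[OF d\<phi>]) (use that \<phi>0 in auto)
    then have "frechet_derivative \<phi> (at z) = (\<lambda>_. 0)"
      by (rule has_derivative_unique) (rule has_derivative_const)
    then show ?thesis by (simp add: D_def)
  qed
  show cFD: "continuous_on UNIV (\<lambda>z. F z * D z)" and cF\<phi>: "continuous_on UNIV (\<lambda>z. F' z v * \<phi> z)"
    by (intro continuous_intros cF cD c\<phi> F(2))+
  have int: "integrable lborel g" if "continuous_on UNIV g" "\<And>z. z \<notin> C \<Longrightarrow> g z = 0"
    for g :: "complex \<Rightarrow> complex"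
  proof -
    have "integrable lborel (\<lambda>x. indicator C x *\<^sub>R g x)"
      by (intro borel_integrable_compact C continuous_on_subset[OF that(1)]) auto
    moreover have "indicator C x *\<^sub>R g x = g x" for x
      using that(2) by (auto simp: indicator_def)
    ultimately show ?thesis by simp
  qed
  show i1: "integrable lborel (\<lambda>z. F z * D z)" and i2: "integrable lborel (\<lambda>z. F' z v * \<phi> z)"
    by (intro int cFD cF\<phi>; simp add: D0 \<phi>0)+
  have "integral\<^sup>L lborel (\<lambda>z. (\<lambda>w. F z * frechet_derivative \<phi> (at z) w + F' z w * \<phi> z) v) = 0"
  proof (rule integral_directional_derivative_eq_0[where \<psi> = "\<lambda>z. F z * \<phi> z", OF _ _ C])
    show "((\<lambda>z. F z * \<phi> z) has_derivative (\<lambda>w. F z * frechet_derivative \<phi> (at z) w + F' z w * \<phi> z)) (at z)" for z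
      by (rule has_derivative_mult[OF F(1) d\<phi>])
    show "continuous_on UNIV (\<lambda>z. F z * frechet_derivative \<phi> (at z) v + F' z v * \<phi> z)"
      using cFD cF\<phi> by (auto simp: D_def intro: continuous_intros)
  qed (simp add: \<phi>0)
  then show "integral\<^sup>L lborel (\<lambda>z. F z * D z) = - integral\<^sup>L lborel (\<lambda>z. F' z v * \<phi> z)"
    using i1 i2 by (simp add: D_def add_eq_0_iff2)
qed

text \<open>With the derivative at \<open>z\<close> written as p v + q cnj v, a positive Jacobian
  means that |q| < |p|, so the p term decides the winding number. Injectivity keeps the images of
  all circles about \<open>z\<close> away from \<open>F z\<close>.\<close>

lemma orientation_preserving_if_jac_det_pos:
  assumes "inj F" and D: "\<And>z. (F has_derivative F' z) (at z)" and J: "\<And>z. 0 < jac_det (F' z)"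
  shows "orientation_preserving_on UNIV F"
  unfolding orientation_preserving_on_def
proof (intro allI impI)
  fix z r assume "0 < r \<and> cball z r \<subseteq> (UNIV::complex set)"
  then have r: "r > 0" by simp
  define L where "L = F' z"
  have L: "bounded_linear L" unfolding L_def using D has_derivative_bounded_linear by blast
  define p where "p = (L 1 - \<i> * L \<i>) / 2"
  define q where "q = (L 1 + \<i> * L \<i>) / 2"
  have Lpq: "L v = p * v + q * cnj v" for v
    by (subst real_linear_complex[OF L]) (simp add: p_def q_def complex_eq_iff field_simps)
  have "(cmod p)\<^sup>2 - (cmod q)\<^sup>2 = jac_det L"
    unfolding cmod_power2 by (simp add: p_def q_def jac_det_def power2_eq_square field_simps)
  then have "(cmod q)\<^sup>2 < (cmod p)\<^sup>2" using J[of z] by (simp add: L_def)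
  then have pq: "cmod q < cmod p" by (rule power_less_imp_less_base) simp
  have Lbelow: "(cmod p - cmod q) * cmod v \<le> cmod (L v)" for v
    using norm_triangle_ineq2[of "p * v" "- (q * cnj v)"] by (simp add: Lpq norm_mult algebra_simps)
  have cF: "continuous_on UNIV F"
    by (intro continuous_at_imp_continuous_on ballI has_derivative_continuous[OF D])
  have "\<forall>e>0. \<exists>d>0. \<forall>y. cmod (y - z) < d \<longrightarrow> cmod (F y - F z - L (y - z)) \<le> e * cmod (y - z)"
    using D[of z] by (simp add: has_derivative_at_alt L_def)
  \<comment> \<open>The linear part is at least (|p| - |q|) |v|. With half of this as error bound,
    the image of the small circle is closer to the linearized loop than that loop is to
    \<open>F z\<close>.\<close>
  then obtain d where d: "d > 0" "\<And>y. cmod (y - z) < d \<Longrightarrow>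
      cmod (F y - F z - L (y - z)) \<le> (cmod p - cmod q) / 2 * cmod (y - z)"
    using pq by (metis diff_gt_0_iff_gt half_gt_zero)
  define s where "s = min r (d / 2)"
  have s: "0 < s" "s \<le> r" "s < d" using r d(1) by (auto simp: s_def)
  define e where "e u = exp (complex_of_real (2 * pi * u) * \<i>)" for u
  have e: "cmod (e u) = 1" for u by (simp add: e_def)
  have ce: "continuous_on A e" for A unfolding e_def by (intro continuous_intros)
  have e01: "e 1 = e 0" by (simp add: e_def exp_two_pi_i mult.commute)
  have cp: "circlepath z \<rho> u = z + complex_of_real \<rho> * e u" for \<rho> u
    by (simp add: circlepath e_def mult_ac)
  have path1: "path (\<lambda>u. F (z + complex_of_real \<rho> * e u))" for \<rho>
    unfolding path_def
    by (intro continuous_on_compose2[OF cF] continuous_intros ce) auto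
  have cL: "continuous_on UNIV L" using L linear_continuous_on by blast
  have ne: "F y \<noteq> F z" if "y \<noteq> z" for y using assms(1) that by (auto dest: injD)

  \<comment> \<open>Shrink the circle, linearize on the small circle, and deform \<open>p v + q (cnj v)\<close> to \<open>p v\<close>.\<close>
  have "homotopic_loops (- {F z}) (\<lambda>u. F (z + complex_of_real r * e u))
          (\<lambda>u. F (z + complex_of_real s * e u))"
    unfolding homotopic_loops
  proof (intro exI conjI ballI allI)
    let ?h = "\<lambda>(t, u). F (z + complex_of_real ((1 - t) * r + t * s) * e u)"
    show "continuous_on ({0..1} \<times> {0..1}) ?h"
      unfolding case_prod_unfold
      by (intro continuous_on_compose2[OF cF] continuous_intros continuous_on_compose2[OF ce]) auto
    show "?h \<in> {0..1} \<times> {0..1} \<rightarrow> - {F z}"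
    proof (clarsimp simp: Pi_iff)
      fix t u :: real assume "0 \<le> t" "t \<le> 1"
        and eq: "F (z + ((1 - complex_of_real t) * complex_of_real r +
                    complex_of_real t * complex_of_real s) * e u) = F z"
      have "(1 - t) * r + t * s > 0"
        using \<open>0 \<le> t\<close> \<open>t \<le> 1\<close> s(1) r by (smt (verit) mult_nonneg_nonneg mult_pos_pos)
      moreover have "e u \<noteq> 0" using e[of u] by auto
      ultimately have "complex_of_real ((1 - t) * r + t * s) * e u \<noteq> 0"
        by (metis less_irrefl no_zero_divisors of_real_eq_0_iff)
      then show False using ne[of "z + complex_of_real ((1 - t) * r + t * s) * e u"] eq by simp
    qed
  qed (auto simp: e01 pathstart_def pathfinish_def)
  then have "winding_number (F \<circ> circlepath z r) (F z)
      = winding_number (\<lambda>u. F (z + complex_of_real s * e u)) (F z)"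
    using winding_number_homotopic_loops by (auto simp: o_def cp)
  also have "\<dots> = winding_number (\<lambda>u. F z + L (complex_of_real s * e u)) (F z)"
  proof (rule winding_number_nearby_loops_eq)
    show "path (\<lambda>u. F z + L (complex_of_real s * e u))"
      unfolding path_def by (intro continuous_intros continuous_on_compose2[OF cL] ce) auto
    fix u :: real
    have n: "cmod (complex_of_real s * e u) = s" using s by (simp add: norm_mult e)
    have "cmod (F (z + complex_of_real s * e u) - F z - L (complex_of_real s * e u))
          \<le> (cmod p - cmod q) / 2 * s"
      using d(2)[of "z + complex_of_real s * e u"] n s by simp
    also have "\<dots> < (cmod p - cmod q) * s" using pq s by simp
    also have "\<dots> \<le> cmod (L (complex_of_real s * e u))"
      using Lbelow[of "complex_of_real s * e u"] n by simp
    finally show "cmod (F (z + complex_of_real s * e u) - (F z + L (complex_of_real s * e u)))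
        < cmod (F z + L (complex_of_real s * e u) - F z)"
      by (simp add: algebra_simps)
  qed (use path1 in \<open>auto simp: e01 pathstart_def pathfinish_def\<close>)
  also have "\<dots> = winding_number (\<lambda>u. F z + p * (complex_of_real s * e u)) (F z)"
  proof (rule winding_number_nearby_loops_eq)
    show "path (\<lambda>u. F z + L (complex_of_real s * e u))"
      unfolding path_def by (intro continuous_intros continuous_on_compose2[OF cL] ce) auto
    show "path (\<lambda>u. F z + p * (complex_of_real s * e u))"
      unfolding path_def by (intro continuous_intros ce)
    fix u :: real
    show "cmod (F z + L (complex_of_real s * e u) - (F z + p * (complex_of_real s * e u)))
        < cmod (F z + p * (complex_of_real s * e u) - F z)"
      using pq s by (simp add: Lpq norm_mult e)
  qed (auto simp: e01 pathstart_def pathfinish_def)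
  also have "\<dots> = winding_number (circlepath (F z) (cmod p * s)) (F z)"
  proof -
    define a where "a = Arg p / (2 * pi)"
    have p: "p = cmod p * exp (\<i> * Arg p)"
      using pq by (metis Arg_eq complex_mod_rcis norm_not_less_zero norm_zero rcis_def cis_conv_exp)
    have "homotopic_loops (- {F z}) (\<lambda>u. F z + p * (complex_of_real s * e u))
          (\<lambda>u. F z + complex_of_real (cmod p * s) * e u)"
      unfolding homotopic_loops
    proof (intro exI conjI ballI allI)
      \<comment> \<open>Turning the argument of \<open>p\<close> down to 0 leaves a genuine
        \<open>circlepath\<close>.\<close>
      let ?h = "\<lambda>(t, u). F z + complex_of_real (cmod p * s) * (exp (\<i> * complex_of_real ((1 - t) * Arg p)) * e u)"
      show "continuous_on ({0..1} \<times> {0..1}) ?h"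
        unfolding case_prod_unfold
        by (intro continuous_intros continuous_on_compose2[OF ce]) auto
      show "?h \<in> {0..1} \<times> {0..1} \<rightarrow> - {F z}"
        using pq s(1) by (auto simp: e_def)
      show "?h (0, u) = F z + p * (complex_of_real s * e u)" for u
        by (subst (2) p) simp
    qed (auto simp: e01 pathstart_def pathfinish_def)
    then show ?thesis
      using winding_number_homotopic_loops by (auto simp: o_def circlepath e_def mult_ac)
  qed
  also have "\<dots> = 1"
    using pq s order.strict_trans1[OF norm_ge_zero pq] by (intro winding_number_circlepath_centre) simp
  finally show "winding_number (F \<circ> circlepath z r) (F z) = 1" .
qed

text \<open>The pointwise Wirtinger derivatives \<open>p\<close>, \<open>q\<close> serve as the
  distributional ones. For the dilatation, (|p| + |q|)^2 is at most \<open>hs_norm2\<close>, which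
  is at most K (|p| - |q|) (|p| + |q|), and one factor |p| + |q| > 0 cancels.\<close>

lemma quasiconformal_on_UNIV_if_C1_qc:
  assumes "C1_qc K F" "1 \<le> K"
  shows "quasiconformal_on K UNIV F"
proof -
  obtain F' where F: "inj F" "\<And>z. (F has_derivative F' z) (at z)"
      "\<And>v. continuous_on UNIV (\<lambda>z. F' z v)"
      "\<And>z. 0 < jac_det (F' z)" "\<And>z. hs_norm2 (F' z) \<le> K * jac_det (F' z)"
    using assms(1) unfolding C1_qc_def by blast
  have cF: "continuous_on UNIV F"
    by (intro continuous_at_imp_continuous_on ballI has_derivative_continuous[OF F(2)])
  define p where "p z = (F' z 1 - \<i> * F' z \<i>) / 2" for z
  define q where "q z = (F' z 1 + \<i> * F' z \<i>) / 2" for z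
  have cp: "continuous_on UNIV p" and cq: "continuous_on UNIV q"
    unfolding p_def q_def by (intro continuous_intros F(3) | simp)+
  have li: "locally_integrable_on g UNIV" if "continuous_on UNIV g" for g :: "complex \<Rightarrow> complex"
    unfolding locally_integrable_on_def
  proof (intro allI impI)
    fix C :: "complex set" assume "compact C \<and> C \<subseteq> UNIV"
    then have C: "compact C" by simp
    then have "set_integrable lborel C g"
      unfolding set_integrable_def
      by (intro borel_integrable_compact continuous_on_subset[OF that]) auto
    then show "g absolutely_integrable_on C"
      unfolding set_integrable_def by (subst integrable_completion) auto
  qed
  have ratio: "(cmod (p z) + cmod (q z)) / (cmod (p z) - cmod (q z)) \<le> K"
    and pq: "cmod (q z) < cmod (p z)" for z
  proof -
    have J: "(cmod (p z))\<^sup>2 - (cmod (q z))\<^sup>2 = jac_det (F' z)"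
      unfolding cmod_power2 by (simp add: p_def q_def jac_det_def power2_eq_square field_simps)
    have H: "2 * ((cmod (p z))\<^sup>2 + (cmod (q z))\<^sup>2) = hs_norm2 (F' z)"
      unfolding cmod_power2 hs_norm2_def by (simp add: p_def q_def power2_eq_square field_simps)
    have "(cmod (q z))\<^sup>2 < (cmod (p z))\<^sup>2" using J F(4)[of z] by simp
    then show pq: "cmod (q z) < cmod (p z)" by (rule power_less_imp_less_base) simp
    have "(cmod (p z) + cmod (q z))\<^sup>2 \<le> 2 * ((cmod (p z))\<^sup>2 + (cmod (q z))\<^sup>2)"
      using zero_le_power2[of "cmod (p z) - cmod (q z)"] by (simp add: power2_eq_square algebra_simps)
    also have "\<dots> \<le> K * ((cmod (p z))\<^sup>2 - (cmod (q z))\<^sup>2)"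
      using F(5)[of z] by (simp only: H J)
    also have "\<dots> = K * (cmod (p z) - cmod (q z)) * (cmod (p z) + cmod (q z))"
      by (simp add: power2_eq_square algebra_simps)
    finally have "cmod (p z) + cmod (q z) \<le> K * (cmod (p z) - cmod (q z))"
      using pq norm_ge_zero[of "q z"] by (simp add: power2_eq_square)
    then show "(cmod (p z) + cmod (q z)) / (cmod (p z) - cmod (q z)) \<le> K"
      using pq by (simp add: divide_le_eq)
  qed
  show ?thesis
    unfolding quasiconformal_on_def
  proof (intro conjI exI)
    \<comment> \<open>Continuity of the inverse is invariance of domain.\<close>
    show "homeomorphism UNIV (F ` UNIV) F (inv_into UNIV F)"
      using continuous_on_inverse_open[of UNIV F "inv_into UNIV F"] cF F(1)
      by (simp add: homeomorphism_def)
    show "orientation_preserving_on UNIV F"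
      by (rule orientation_preserving_if_jac_det_pos[OF F(1,2,4)])
    show "locally_integrable_on p UNIV" "locally_integrable_on q UNIV"
      using li cp cq by blast+
    show "distributional_d_z UNIV F p"
      unfolding distributional_d_z_def
    proof (intro allI impI)
      fix \<phi> assume \<phi>: "test_function_on UNIV \<phi>"
      note x = integral_by_parts_test_function[OF F(2,3) \<phi>, of 1]
      note y = integral_by_parts_test_function[OF F(2,3) \<phi>, of \<i>]
      have "integral\<^sup>L (lebesgue_on UNIV) (\<lambda>z. F z * d_z \<phi> z) = integral\<^sup>L lborel (\<lambda>z. F z * d_z \<phi> z)"
      proof (rule lebesgue_integral_eq_lborel)
        have "continuous_on UNIV (\<lambda>z. (F z * frechet_derivative \<phi> (at z) 1
            - \<i> * (F z * frechet_derivative \<phi> (at z) \<i>)) / 2)"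
          by (intro continuous_intros x(4) y(4)) auto
        then show "continuous_on UNIV (\<lambda>z. F z * d_z \<phi> z)"
          by (simp add: d_z_def algebra_simps)
      qed
      also have "\<dots> = integral\<^sup>L lborel (\<lambda>z. (F z * frechet_derivative \<phi> (at z) 1
            - \<i> * (F z * frechet_derivative \<phi> (at z) \<i>)) / 2)"
        by (simp add: d_z_def algebra_simps)
      also have "\<dots> = - integral\<^sup>L lborel (\<lambda>z. (F' z 1 * \<phi> z - \<i> * (F' z \<i> * \<phi> z)) / 2)"
        using x(1-3) y(1-3) by (simp add: field_simps)
      also have "\<dots> = - integral\<^sup>L lborel (\<lambda>z. p z * \<phi> z)"
        by (simp add: p_def algebra_simps)
      also have "\<dots> = - integral\<^sup>L (lebesgue_on UNIV) (\<lambda>z. p z * \<phi> z)"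
      proof (subst lebesgue_integral_eq_lborel)
        have "continuous_on UNIV (\<lambda>z. (F' z 1 * \<phi> z - \<i> * (F' z \<i> * \<phi> z)) / 2)"
          by (intro continuous_intros x(5) y(5)) auto
        then show "continuous_on UNIV (\<lambda>z. p z * \<phi> z)"
          by (simp add: p_def algebra_simps)
      qed simp
      finally show "integral\<^sup>L (lebesgue_on UNIV) (\<lambda>z. F z * d_z \<phi> z)
          = - integral\<^sup>L (lebesgue_on UNIV) (\<lambda>z. p z * \<phi> z)" .
    qed
    show "distributional_d_zbar UNIV F q"
      unfolding distributional_d_zbar_def
    proof (intro allI impI)
      fix \<phi> assume \<phi>: "test_function_on UNIV \<phi>"
      note x = integral_by_parts_test_function[OF F(2,3) \<phi>, of 1]
      note y = integral_by_parts_test_function[OF F(2,3) \<phi>, of \<i>]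
      have "integral\<^sup>L (lebesgue_on UNIV) (\<lambda>z. F z * d_zbar \<phi> z) = integral\<^sup>L lborel (\<lambda>z. F z * d_zbar \<phi> z)"
      proof (rule lebesgue_integral_eq_lborel)
        have "continuous_on UNIV (\<lambda>z. (F z * frechet_derivative \<phi> (at z) 1
            + \<i> * (F z * frechet_derivative \<phi> (at z) \<i>)) / 2)"
          by (intro continuous_intros x(4) y(4)) auto
        then show "continuous_on UNIV (\<lambda>z. F z * d_zbar \<phi> z)"
          by (simp add: d_zbar_def algebra_simps)
      qed
      also have "\<dots> = integral\<^sup>L lborel (\<lambda>z. (F z * frechet_derivative \<phi> (at z) 1
            + \<i> * (F z * frechet_derivative \<phi> (at z) \<i>)) / 2)"
        by (simp add: d_zbar_def algebra_simps)
      also have "\<dots> = - integral\<^sup>L lborel (\<lambda>z. (F' z 1 * \<phi> z + \<i> * (F' z \<i> * \<phi> z)) / 2)"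
        using x(1-3) y(1-3) by (simp add: field_simps)
      also have "\<dots> = - integral\<^sup>L lborel (\<lambda>z. q z * \<phi> z)"
        by (simp add: q_def algebra_simps)
      also have "\<dots> = - integral\<^sup>L (lebesgue_on UNIV) (\<lambda>z. q z * \<phi> z)"
      proof (subst lebesgue_integral_eq_lborel)
        have "continuous_on UNIV (\<lambda>z. (F' z 1 * \<phi> z + \<i> * (F' z \<i> * \<phi> z)) / 2)"
          by (intro continuous_intros x(5) y(5)) auto
        then show "continuous_on UNIV (\<lambda>z. q z * \<phi> z)"
          by (simp add: q_def algebra_simps)
      qed simp
      finally show "integral\<^sup>L (lebesgue_on UNIV) (\<lambda>z. F z * d_zbar \<phi> z)
          = - integral\<^sup>L (lebesgue_on UNIV) (\<lambda>z. q z * \<phi> z)" .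
    qed
    have "ereal (cmod (p z) + cmod (q z)) / ereal (cmod (p z) - cmod (q z))
        = ereal ((cmod (p z) + cmod (q z)) / (cmod (p z) - cmod (q z)))" for z
      using pq[of z] by simp
    \<comment> \<open>\<open>esssup\<close> is the top element for non-measurable functions, so an
      upper bound needs measurability besides the pointwise estimate.\<close>
    moreover have "continuous_on UNIV (\<lambda>z. (cmod (p z) + cmod (q z)) / (cmod (p z) - cmod (q z)))"
      using less_imp_neq[OF pq] by (intro continuous_intros cp cq) (metis eq_iff_diff_eq_0 UNIV_I)
    then have "(\<lambda>z. (cmod (p z) + cmod (q z)) / (cmod (p z) - cmod (q z))) \<in> borel_measurable lborel"
      by (simp add: borel_measurable_continuous_onI)
    then have "(\<lambda>z. ereal ((cmod (p z) + cmod (q z)) / (cmod (p z) - cmod (q z)))) \<in> borel_measurable (lebesgue_on UNIV)"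
      by (simp add: lebesgue_on_UNIV_eq measurable_completion)
    ultimately show "esssup (lebesgue_on UNIV)
        (\<lambda>z. ereal (cmod (p z) + cmod (q z)) / ereal (cmod (p z) - cmod (q z))) \<le> ereal K"
      using ratio by (intro esssup_I) auto
  qed (use assms(2) in auto)
qed

section \<open>Shears and bounded displacements\<close>

lemma DERIV_max_0_power2:
  "((\<lambda>s. (max 0 s)\<^sup>2) has_real_derivative 2 * max 0 s) (at s)"
proof (cases s "0::real" rule: linorder_cases)
  case less
  have "((\<lambda>_. 0) has_real_derivative 2 * max 0 s) (at s)" using less by simp
  then show ?thesis
    by (rule has_field_derivative_transform_within_open[where S="{..<0}"]) (use less in auto)
next
  case greater
  have "((\<lambda>s. s\<^sup>2) has_real_derivative 2 * max 0 s) (at s)"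
    using greater by (auto intro!: derivative_eq_intros)
  then show ?thesis
    by (rule has_field_derivative_transform_within_open[where S="{0<..}"]) (use greater in auto)
next
  case equal
  have "((\<lambda>h. (max 0 h)\<^sup>2 / h) \<longlongrightarrow> 0) (at (0::real))"
  proof (rule Lim_null_comparison)
    show "\<forall>\<^sub>F h in at 0. norm ((max 0 h)\<^sup>2 / h) \<le> norm (h::real)"
      by (intro always_eventually allI) (auto simp: max_def power2_eq_square)
    show "((\<lambda>h. norm h) \<longlongrightarrow> 0) (at (0::real))" by (rule tendsto_norm_zero) simp
  qed
  then show ?thesis by (simp add: equal DERIV_def)
qed

text \<open>Squaring the positive part makes this C^1, with an explicit derivative. The type is a
  general inner product space because the bumps are used on the line for vertical shears and in the
  plane for the horizontal one.\<close>

definition bump :: "'a::real_inner \<Rightarrow> real" where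
  "bump x = (max 0 (1 - (norm x)\<^sup>2))\<^sup>2"

definition bump' :: "'a::real_inner \<Rightarrow> 'a \<Rightarrow> real" where
  "bump' x v = - 4 * max 0 (1 - (norm x)\<^sup>2) * (x \<bullet> v)"

lemma bump_0: "bump 0 = 1"
  by (simp add: bump_def)

lemma bump_eq_0: "1 \<le> norm x \<Longrightarrow> bump x = 0"
  by (simp add: bump_def one_le_power)

lemma has_derivative_bump: "(bump has_derivative bump' x) (at x)"
proof -
  have "((\<lambda>x. 1 - (norm x)\<^sup>2) has_derivative (\<lambda>v. - (2 * (x \<bullet> v)))) (at x)"
    unfolding power2_norm_eq_inner
    by (auto intro!: derivative_eq_intros simp: inner_commute)
  from has_derivative_compose[OF this DERIV_max_0_power2[unfolded has_field_derivative_def]]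
  show ?thesis
    by (simp add: bump_def[abs_def] bump'_def[abs_def] mult_ac)
qed

lemma continuous_on_bump': "continuous_on S (\<lambda>x. bump' x v)"
  unfolding bump'_def by (intro continuous_intros)

lemma abs_bump'_le: "\<bar>bump' x v\<bar> \<le> 4 * norm v"
proof (cases "norm x \<le> 1")
  case True
  have "\<bar>bump' x v\<bar> = 4 * (1 - (norm x)\<^sup>2) * \<bar>x \<bullet> v\<bar>"
    using True by (simp add: bump'_def abs_mult max_def power_le_one)
  also have "\<dots> \<le> 4 * 1 * (norm x * norm v)"
    using True by (intro mult_mono Cauchy_Schwarz_ineq2) (auto simp: power_le_one)
  also have "\<dots> \<le> 4 * norm v"
    using True by (simp add: mult_left_le_one_le)
  finally show ?thesis .
next
  case False
  then have "1 \<le> (norm x)\<^sup>2" by (simp add: one_le_power)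
  then show ?thesis by (simp add: bump'_def)
qed

text \<open>\<open>c\<close> is the sum of the bumps of height \<open>w p\<close> supported in the
  balls of radius \<delta>/3 about the points \<open>p\<close>. At most one term is non-zero at any
  point, so a choice of \<open>p\<close> replaces the sum. The constant 12 is the bound 4 for
  \<open>bump'\<close> times the factor 3 of the rescaling.\<close>

lemma C1_interpolation_separated:
  fixes P :: "'a::real_inner set" and w :: "'a \<Rightarrow> real"
  assumes \<delta>: "\<delta> > 0" and sep: "\<And>p q. p \<in> P \<Longrightarrow> q \<in> P \<Longrightarrow> p \<noteq> q \<Longrightarrow> \<delta> \<le> dist p q"
    and W: "\<And>p. p \<in> P \<Longrightarrow> \<bar>w p\<bar> \<le> W" "0 \<le> W"
  obtains c c' where "\<And>p. p \<in> P \<Longrightarrow> c p = w p"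
    and "\<And>x. (c has_derivative c' x) (at x)" and "\<And>v. continuous_on UNIV (\<lambda>x. c' x v)"
    and "\<And>x v. \<bar>c' x v\<bar> \<le> 12 * W / \<delta> * norm v"
proof -
  define near where "near x p \<longleftrightarrow> p \<in> P \<and> dist x p < \<delta> / 3" for x p
  define c where "c x = (if \<exists>p. near x p then
      (let p = (SOME p. near x p) in w p * bump ((3 / \<delta>) *\<^sub>R (x - p))) else 0)" for x
  have uniq: "p = q" if "p \<in> P" "dist x p < \<delta> / 2" "q \<in> P" "dist x q < \<delta> / 2" for x p q
    using sep[of p q] dist_triangle2[of p q x] that by (force simp: dist_commute)
  have c_near: "c x = w p * bump ((3 / \<delta>) *\<^sub>R (x - p))" if "p \<in> P" "dist x p < \<delta> / 2" for x p
  proof (cases "\<exists>q. near x q")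
    case True
    then have "near x (SOME q. near x q)" by (rule someI_ex)
    then have "(SOME q. near x q) = p"
      using uniq[of "SOME q. near x q" x p] that \<delta> by (simp add: near_def)
    then show ?thesis using True by (simp add: c_def)
  next
    case False
    then have "\<delta> / 3 \<le> norm (x - p)"
      using that by (simp add: near_def dist_norm not_less)
    then have "1 \<le> norm ((3 / \<delta>) *\<^sub>R (x - p))"
      using \<delta> by (simp only: norm_scaleR) (simp add: field_simps)
    then show ?thesis using False by (simp add: c_def bump_eq_0)
  qed
  \<comment> \<open>Here the radius is \<delta>/2 instead of \<delta>/3: these balls are still
    disjoint, and being open they contain a neighbourhood of each closed support, so that one
    formula holds around every point of a support.\<close>
  define c' where "c' x = (if \<exists>p\<in>P. dist x p < \<delta> / 2 then
      (let p = (SOME p. p \<in> P \<and> dist x p < \<delta> / 2) in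
        (\<lambda>v. w p * bump' ((3 / \<delta>) *\<^sub>R (x - p)) ((3 / \<delta>) *\<^sub>R v))) else (\<lambda>v. 0))" for x
  have c'_near: "c' x = (\<lambda>v. w p * bump' ((3 / \<delta>) *\<^sub>R (x - p)) ((3 / \<delta>) *\<^sub>R v))"
    if "p \<in> P" "dist x p < \<delta> / 2" for x p
  proof -
    have "(SOME p. p \<in> P \<and> dist x p < \<delta> / 2) = p"
    proof (rule some_equality)
      show "q = p" if "q \<in> P \<and> dist x q < \<delta> / 2" for q
        using uniq[of q x p] that \<open>p \<in> P\<close> \<open>dist x p < \<delta> / 2\<close> by blast
    qed (use that in blast)
    moreover have "\<exists>p\<in>P. dist x p < \<delta> / 2" using that by blast
    ultimately show ?thesis by (simp add: c'_def)
  qed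
  have local: "\<exists>S f f'. open S \<and> x \<in> S \<and> (\<forall>y\<in>S. c y = f y \<and> c' y = f' y) \<and>
      (\<forall>y. (f has_derivative f' y) (at y)) \<and> (\<forall>v. continuous_on UNIV (\<lambda>x. f' x v))" for x
  proof (cases "\<exists>p\<in>P. dist x p < \<delta> / 2")
    case True
    then obtain p where p: "p \<in> P" "dist x p < \<delta> / 2" by blast
    let ?f = "\<lambda>x. w p * bump ((3 / \<delta>) *\<^sub>R (x - p))"
    let ?f' = "\<lambda>x v. w p * bump' ((3 / \<delta>) *\<^sub>R (x - p)) ((3 / \<delta>) *\<^sub>R v)"
    have "(?f has_derivative ?f' y) (at y)" for y
    proof -
      have "((\<lambda>x. (3 / \<delta>) *\<^sub>R (x - p)) has_derivative (\<lambda>v. (3 / \<delta>) *\<^sub>R v)) (at y)"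
        by (auto intro!: derivative_eq_intros)
      from has_derivative_compose[OF this has_derivative_bump]
      show ?thesis by (rule has_derivative_mult_right)
    qed
    moreover have "continuous_on UNIV (\<lambda>x. ?f' x v)" for v
      by (intro continuous_intros continuous_on_compose2[OF continuous_on_bump'[of UNIV]]) auto
    ultimately show ?thesis
      using p c_near c'_near
      by (intro exI[of _ "ball p (\<delta> / 2)"] exI[of _ ?f] exI[of _ ?f']) (auto simp: dist_commute)
  next
    case False
    \<comment> \<open>\<delta>/6 is the gap \<delta>/2 - \<delta>/3: points this close to
      \<open>x\<close> stay outside all open balls of radius \<delta>/3.\<close>
    then have far: "\<delta> / 3 \<le> dist y p" if "p \<in> P" "y \<in> ball x (\<delta> / 6)" for p y
      using that dist_triangle[of x p y] by (auto simp: not_less)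
    have "c y = 0 \<and> c' y = (\<lambda>v. 0)" if "y \<in> ball x (\<delta> / 6)" for y
    proof
      show "c y = 0" using far[OF _ that] by (auto simp: c_def near_def not_less[symmetric])
      show "c' y = (\<lambda>v. 0)"
      proof (cases "\<exists>p\<in>P. dist y p < \<delta> / 2")
        case True
        then obtain p where p: "p \<in> P" "dist y p < \<delta> / 2" by blast
        have "1 \<le> norm ((3 / \<delta>) *\<^sub>R (y - p))"
          using far[OF p(1) that] \<delta> by (simp only: norm_scaleR dist_norm) (simp add: field_simps)
        then have "1 \<le> (norm ((3 / \<delta>) *\<^sub>R (y - p)))\<^sup>2" by (simp add: one_le_power)
        then show ?thesis
          unfolding c'_near[OF p] by (simp add: bump'_def)
      qed (simp add: c'_def)
    qed
    then show ?thesis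
      using \<delta> by (intro exI[of _ "ball x (\<delta> / 6)"] exI[of _ "\<lambda>_. 0"] exI[of _ "\<lambda>_ _. 0"]) auto
  qed
  show ?thesis
  proof
    show "c p = w p" if "p \<in> P" for p
      using c_near[OF that, of p] \<delta> by (simp add: bump_0)
    show "(c has_derivative c' x) (at x)" for x
    proof -
      obtain S f f' where S: "open S" "x \<in> S" "\<And>y. y \<in> S \<Longrightarrow> c y = f y \<and> c' y = f' y"
        "\<And>y. (f has_derivative f' y) (at y)"
        using local[of x] by blast
      have "(c has_derivative f' x) (at x)"
        by (rule has_derivative_transform_within_open[OF S(4,1,2)]) (use S(3) in auto)
      then show ?thesis using S(2,3) by auto
    qed
    show "continuous_on UNIV (\<lambda>x. c' x v)" for v
    proof (intro continuous_at_imp_continuous_on ballI)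
      fix x
      obtain S f' where S: "open S" "x \<in> S" "\<And>y. y \<in> S \<Longrightarrow> c' y = f' y"
        "\<And>v. continuous_on UNIV (\<lambda>x. f' x v)"
        using local[of x] by blast
      have "continuous_on S (\<lambda>x. c' x v)"
        using continuous_on_subset[OF S(4)[of v], of S] S(3)
        by (subst continuous_on_cong[OF refl, of S _ "\<lambda>x. f' x v"]) auto
      then show "isCont (\<lambda>x. c' x v) x"
        using S(1,2) continuous_on_eq_continuous_at by blast
    qed
    show "\<bar>c' x v\<bar> \<le> 12 * W / \<delta> * norm v" for x v
    proof (cases "\<exists>p\<in>P. dist x p < \<delta> / 2")
      case True
      then obtain p where p: "p \<in> P" "dist x p < \<delta> / 2" by blast
      have "\<bar>c' x v\<bar> = \<bar>w p\<bar> * \<bar>bump' ((3 / \<delta>) *\<^sub>R (x - p)) ((3 / \<delta>) *\<^sub>R v)\<bar>"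
        by (simp add: c'_near[OF p] abs_mult)
      also have "\<dots> \<le> W * (4 * norm ((3 / \<delta>) *\<^sub>R v))"
        by (intro mult_mono W p abs_bump'_le) auto
      finally show ?thesis using \<delta> by (simp add: algebra_simps)
    next
      case False
      then show ?thesis using W \<delta> by (simp add: c'_def)
    qed
  qed
qed

text \<open>The Jacobian is 1 plus the derivative of \<open>h\<close> in direction \<open>a\<close>.
  Points with the same image lie on a common line in direction \<open>a\<close>, on which t + h is
  strictly increasing; hence injectivity. The constant combines \<open>hs_norm2\<close> at most 2 (1
  + C)^2 with a Jacobian of at least 1/2.\<close>

lemma C1_qc_shear:
  fixes h :: "complex \<Rightarrow> real"
  assumes a: "cmod a = 1" and h: "\<And>z. (h has_derivative h' z) (at z)"
      "\<And>v. continuous_on UNIV (\<lambda>z. h' z v)"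
    and C: "\<And>z v. \<bar>h' z v\<bar> \<le> C * cmod v" "0 \<le> C" and pos: "\<And>z. 1 / 2 \<le> 1 + h' z a"
  shows "C1_qc (4 * (1 + C)\<^sup>2) (\<lambda>z. z + a * of_real (h z))"
proof -
  let ?D = "\<lambda>z v. v + a * of_real (h' z v)"
  have lin: "bounded_linear (h' z)" for z using h(1) has_derivative_bounded_linear by blast
  have "inj (\<lambda>z. z + a * of_real (h z))"
  proof (rule injI)
    fix z w assume eq: "z + a * of_real (h z) = w + a * of_real (h w)"
    define s where "s = h z - h w"
    have w: "w = z + a * of_real s" using eq by (simp add: s_def algebra_simps)
    define \<phi> where "\<phi> t = h (z + a * of_real t) + t" for t
    have d: "(\<phi> has_real_derivative h' (z + a * of_real t) a + 1) (at t)" for t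
    proof -
      have "((\<lambda>t. z + a * of_real t) has_derivative (\<lambda>x. x *\<^sub>R a)) (at t)"
        by (auto intro!: derivative_eq_intros simp: scaleR_conv_of_real)
      from has_derivative_compose[OF this h(1)]
      have "((\<lambda>t. h (z + a * of_real t)) has_derivative (\<lambda>x. x * h' (z + a * of_real t) a)) (at t)"
        using lin by (simp add: linear_simps)
      then show ?thesis unfolding \<phi>_def
        by (auto intro!: derivative_eq_intros simp: has_field_derivative_def algebra_simps fun_eq_iff)
    qed
    have inc: "\<phi> t < \<phi> u" if "t < u" for t u
      using that by (rule DERIV_pos_imp_increasing) (use d pos in \<open>smt (verit) half_gt_zero_iff\<close>)
    have "h (z + a * of_real s) = h w" using w by (simp only:)
    then have "\<phi> 0 = \<phi> s" unfolding \<phi>_def by (simp add: s_def)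
    then have "s = 0" using inc[of 0 s] inc[of s 0] by (cases s "0::real" rule: linorder_cases) auto
    then show "z = w" using w by simp
  qed
  moreover have "((\<lambda>z. z + a * of_real (h z)) has_derivative ?D z) (at z)" for z
    by (auto intro!: derivative_eq_intros has_derivative_of_real h)
  moreover have "continuous_on UNIV (\<lambda>z. ?D z v)" for v
    by (intro continuous_intros h)
  moreover have J: "1 / 2 \<le> jac_det (?D z)" for z
  proof -
    have "h' z a = Re a * h' z 1 + Im a * h' z \<i>"
    proof -
      interpret bounded_linear "h' z" by (rule lin)
      have "h' z a = h' z (Re a *\<^sub>R 1 + Im a *\<^sub>R \<i>)"
        by (metis complex_eq scaleR_conv_of_real mult.commute mult.right_neutral)
      then show ?thesis by (simp only: add scaleR real_scaleR_def)
    qed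
    then have "jac_det (?D z) = 1 + h' z a"
      by (simp add: jac_det_def algebra_simps)
    then show ?thesis using pos[of z] by simp
  qed
  moreover have "hs_norm2 (?D z) \<le> 4 * (1 + C)\<^sup>2 * jac_det (?D z)" for z
  proof -
    have "cmod (?D z v) \<le> 1 + C" if "cmod v = 1" for v
      using norm_triangle_ineq[of v "a * of_real (h' z v)"] C(1)[of z v] that a
      by (simp add: norm_mult)
    then have "(cmod (?D z v))\<^sup>2 \<le> (1 + C)\<^sup>2" if "cmod v = 1" for v
      using that by (intro power_mono) auto
    from this[of 1] this[of \<i>] have "hs_norm2 (?D z) \<le> 2 * (1 + C)\<^sup>2"
      by (simp add: hs_norm2_def)
    also have "\<dots> \<le> 4 * (1 + C)\<^sup>2 * jac_det (?D z)"
      using mult_left_mono[OF J[of z], of "4 * (1 + C)\<^sup>2"] by simp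
    finally show ?thesis .
  qed
  ultimately show ?thesis
    unfolding C1_qc_def
    by (intro conjI exI[of _ ?D] allI) (auto intro: less_le_trans[OF _ J])
qed

text \<open>Since \<sigma> need not be monotone, points have to pass each other, which happens at
  different heights. \<open>K\<close> is fixed before \<sigma>: lifting and dropping involve only
  the bound \<open>W\<close> on the heights and the separations 1 and \<delta>.\<close>

lemma C1_qc_bounded_displacement:
  assumes D: "0 \<le> D" and \<delta>: "0 < \<delta>"
  obtains K where "\<And>\<sigma> :: int \<Rightarrow> real. (\<And>n. \<bar>\<sigma> n - of_int n\<bar> \<le> D) \<Longrightarrow>
    (\<And>m n. m \<noteq> n \<Longrightarrow> \<delta> \<le> \<bar>\<sigma> m - \<sigma> n\<bar>) \<Longrightarrow>
    \<exists>S. C1_qc K S \<and> (\<forall>n. S (of_int n) = of_real (\<sigma> n))"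
proof -
  \<comment> \<open>24 makes the derivative bound 12 D / N of the horizontal shear at most 1/2, as
    \<open>C1_qc_shear\<close> demands; the added 1 gives N > 0 also for D = 0.\<close>
  define N where "N = \<lceil>24 * D\<rceil> + 1"
  have N: "0 < N" "24 * D \<le> of_int N" using D unfolding N_def by linarith+
  define W where "W = (real_of_int N)\<^sup>2"
  define ht where "ht n = real_of_int (N * (n mod N))" for n
  have ht: "\<bar>ht n\<bar> \<le> W" for n
  proof -
    have "0 \<le> n mod N" "n mod N \<le> N" using N(1) by (auto simp: less_imp_le)
    then have "0 \<le> N * (n mod N)" "N * (n mod N) \<le> N * N" using N(1) by (auto intro: mult_left_mono)
    then have "0 \<le> real_of_int (N * (n mod N))" "real_of_int (N * (n mod N)) \<le> real_of_int (N * N)"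
      by (simp_all only: of_int_le_iff of_int_0_le_iff)
    then show ?thesis by (simp add: ht_def W_def power2_eq_square)
  qed
  have W: "0 \<le> W" by (simp add: W_def)
  \<comment> \<open>The displacement depends on \<open>Re z\<close> only, so its derivative in
    direction \<open>\<i>\<close> is 0 and the Jacobian is 1, however steep the shear is.\<close>
  have vertical: "\<exists>S. C1_qc (4 * (1 + 12 * W / \<epsilon>)\<^sup>2) S \<and> (\<forall>p\<in>P. \<forall>y. S (Complex p y) = Complex p (y + w p))"
    if P: "0 < \<epsilon>" "\<And>p q. p \<in> P \<Longrightarrow> q \<in> P \<Longrightarrow> p \<noteq> q \<Longrightarrow> \<epsilon> \<le> dist p q" "\<And>p. p \<in> P \<Longrightarrow> \<bar>w p\<bar> \<le> W"
    for \<epsilon> and P :: "real set" and w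
  proof -
    obtain c c' where c: "\<And>p. p \<in> P \<Longrightarrow> c p = w p" "\<And>x. (c has_derivative c' x) (at x)"
      "\<And>v. continuous_on UNIV (\<lambda>x. c' x v)" "\<And>x v. \<bar>c' x v\<bar> \<le> 12 * W / \<epsilon> * norm v"
      by (rule C1_interpolation_separated[of \<epsilon> P w W, OF P(1) _ _ W]) (rule P(2) P(3) that; assumption)+
    have "C1_qc (4 * (1 + 12 * W / \<epsilon>)\<^sup>2) (\<lambda>z. z + \<i> * of_real (c (Re z)))"
    proof (rule C1_qc_shear)
      show "((\<lambda>z. c (Re z)) has_derivative (\<lambda>v. c' (Re z) (Re v))) (at z)" for z
        by (rule has_derivative_compose[OF bounded_linear_imp_has_derivative[OF bounded_linear_Re] c(2)])
      show "continuous_on UNIV (\<lambda>z. c' (Re z) (Re v))" for v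
        by (intro continuous_on_compose2[OF c(3)] continuous_intros) auto
      show "\<bar>c' (Re z) (Re v)\<bar> \<le> 12 * W / \<epsilon> * cmod v" for z v

        using c(4)[of "Re z" "Re v"] mult_left_mono[OF abs_Re_le_cmod[of v], of "12 * W / \<epsilon>"] W P(1)
        by simp
      show "1 / 2 \<le> 1 + c' (Re z) (Re \<i>)" for z
        using c(4)[of "Re z" 0] by simp
    qed (use W P(1) in auto)
    then show ?thesis
      using c(1) by (intro exI conjI) (auto simp: complex_eq_iff)
  qed
  define K where "K = 4 * (1 + 12 * W / \<delta>)\<^sup>2 * (9 * (4 * (1 + 12 * W / 1)\<^sup>2))"
  show ?thesis
  proof (rule that[of K])
    fix \<sigma> :: "int \<Rightarrow> real"
    assume disp: "\<And>n. \<bar>\<sigma> n - of_int n\<bar> \<le> D" and sep: "\<And>m n. m \<noteq> n \<Longrightarrow> \<delta> \<le> \<bar>\<sigma> m - \<sigma> n\<bar>"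
    have inj: "inj \<sigma>" using sep \<delta> by (force simp: inj_def)
    obtain A1 where A1: "C1_qc (4 * (1 + 12 * W / 1)\<^sup>2) A1"
      "\<And>n y. A1 (Complex (of_int n) y) = Complex (of_int n) (y + ht n)"
    proof -
      have *: "1 \<le> dist p q" if "p \<in> \<int>" "q \<in> \<int>" "p \<noteq> q" for p q :: real
        using that by (auto simp: dist_real_def elim!: Ints_cases)
      have "\<exists>S. C1_qc (4 * (1 + 12 * W / 1)\<^sup>2) S \<and> (\<forall>p\<in>\<int>. \<forall>y. S (Complex p y) = Complex p (y + ht \<lfloor>p\<rfloor>))"
        by (rule vertical) (use * ht in auto)
      then show ?thesis using that by (metis Ints_of_int floor_of_int)
    qed
    obtain A2 where A2: "C1_qc (4 * (1 + 12 * W / \<delta>)\<^sup>2) A2"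
      "\<And>n y. A2 (Complex (\<sigma> n) y) = Complex (\<sigma> n) (y - ht n)"
    proof -
      have *: "\<delta> \<le> dist p q" if "p \<in> range \<sigma>" "q \<in> range \<sigma>" "p \<noteq> q" for p q
        using that sep unfolding dist_real_def by (metis imageE)
      have "\<exists>S. C1_qc (4 * (1 + 12 * W / \<delta>)\<^sup>2) S \<and>
          (\<forall>p\<in>range \<sigma>. \<forall>y. S (Complex p y) = Complex p (y + - ht (inv \<sigma> p)))"
        by (rule vertical) (use * ht \<delta> in auto)
      then obtain S where "C1_qc (4 * (1 + 12 * W / \<delta>)\<^sup>2) S"
        "\<forall>p\<in>range \<sigma>. \<forall>y. S (Complex p y) = Complex p (y + - ht (inv \<sigma> p))" by blast
      then show ?thesis using that[of S] inj by (simp add: inv_f_f)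
    qed
    define pt where "pt n = Complex (of_int n) (ht n)" for n
    have pt_sep: "of_int N \<le> dist (pt m) (pt n)" if "m \<noteq> n" for m n
    \<comment> \<open>Points with equal residues are at least N apart horizontally; for different
      residues the heights, multiples of N, are at least N apart.\<close>
    proof (cases "m mod N = n mod N")
      case True
      then have "N dvd m - n" by (simp add: mod_eq_dvd_iff)
      then have "N \<le> \<bar>m - n\<bar>" using that N(1) by (simp add: zdvd_imp_le dvd_abs_iff)
      then have "of_int N \<le> \<bar>real_of_int m - real_of_int n\<bar>"
        by (metis of_int_abs of_int_diff of_int_le_iff)
      also have "\<dots> \<le> dist (pt m) (pt n)"
        using abs_Re_le_cmod[of "pt m - pt n"] by (simp add: pt_def dist_norm)
      finally show ?thesis .
    next
      case False
      then have "N * 1 \<le> N * \<bar>m mod N - n mod N\<bar>" using N(1) by (intro mult_left_mono) auto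
      then have "of_int N \<le> real_of_int (N * \<bar>m mod N - n mod N\<bar>)" by (simp only: of_int_le_iff mult_1_right)
      also have "\<dots> = \<bar>ht m - ht n\<bar>"
        using N(1) by (simp add: ht_def abs_mult flip: right_diff_distrib of_int_diff)
      also have "\<dots> \<le> dist (pt m) (pt n)"
        using abs_Im_le_cmod[of "pt m - pt n"] by (simp add: pt_def dist_norm)
      finally show ?thesis .
    qed
    obtain B where B: "C1_qc 9 B" "\<And>n. B (pt n) = Complex (\<sigma> n) (ht n)"
    proof -
      obtain c c' where c: "\<And>p. p \<in> range pt \<Longrightarrow> c p = \<sigma> \<lfloor>Re p\<rfloor> - of_int \<lfloor>Re p\<rfloor>"
        "\<And>x. (c has_derivative c' x) (at x)"
        "\<And>v. continuous_on UNIV (\<lambda>x. c' x v)" "\<And>x v. \<bar>c' x v\<bar> \<le> 12 * D / of_int N * norm v"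
      proof (rule C1_interpolation_separated[of "of_int N" "range pt" "\<lambda>p. \<sigma> \<lfloor>Re p\<rfloor> - of_int \<lfloor>Re p\<rfloor>" D])
        show "of_int N \<le> dist p q" if "p \<in> range pt" "q \<in> range pt" "p \<noteq> q" for p q
          using that pt_sep by (metis imageE)
      qed (use N D disp in auto)
      have half: "12 * D / of_int N \<le> 1 / 2" using N by (simp add: field_simps)
      have bd: "\<bar>c' z v\<bar> \<le> 1 / 2 * cmod v" for z v
        using c(4)[of z v] mult_right_mono[OF half norm_ge_zero[of v]] by linarith
      have "C1_qc (4 * (1 + 1 / 2)\<^sup>2) (\<lambda>z. z + 1 * of_real (c z))"
      proof (rule C1_qc_shear[OF _ c(2,3) bd])
        show "1 / 2 \<le> 1 + c' z 1" for z using bd[of z 1] by simp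
      qed auto
      moreover have "pt n + 1 * of_real (c (pt n)) = Complex (\<sigma> n) (ht n)" for n
        by (simp add: c(1) complex_eq_iff) (simp add: pt_def)
      ultimately show ?thesis using that by (simp add: power2_eq_square)
    qed
    have "C1_qc K (A2 \<circ> (B \<circ> A1))"
      unfolding K_def by (intro C1_qc_comp A1 A2 B)
    moreover have "(A2 \<circ> (B \<circ> A1)) (of_int n) = of_real (\<sigma> n)" for n
    proof -
      have "A1 (of_int n) = pt n" using A1(2)[of n 0] by (simp add: pt_def complex_of_real_def[symmetric])
      then show ?thesis by (simp add: B(2) A2(2) complex_of_real_def)
    qed
    ultimately show "\<exists>S. C1_qc K S \<and> (\<forall>n. S (of_int n) = of_real (\<sigma> n))" by blast
  qed
qed

section \<open>The Beurling-Ahlfors extension\<close>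

text \<open>The classical formula makes sense for \<open>Im z < 0\<close> as well, where it gives the reflected
  extension; the map is \<open>C\<^sup>1\<close> across the real line because \<open>G\<close> is.\<close>

lemma C1_qc_Beurling_Ahlfors:
  fixes G g :: "real \<Rightarrow> real"
  assumes G: "\<And>x. (G has_real_derivative g x) (at x)" and g: "continuous_on UNIV g" "\<And>x. 0 < g x"
    and c: "\<And>x y. \<bar>G (x + y) - G x\<bar> \<le> c * \<bar>G x - G (x - y)\<bar>"
  obtains \<Phi> where "C1_qc (4 * c * (1 + c)) \<Phi>" "\<And>x. \<Phi> (of_real x) = of_real (G x)"
proof -
  \<comment> \<open>\<alpha> is the mean of \<open>G\<close> between Re z and Re z + Im z, and its
    value at \<open>cnj z\<close> is the mean on the other side. \<open>A\<close> and
    \<open>B\<close> are its partial derivatives in x and y.\<close>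
  define \<alpha> where "\<alpha> z = integral {0..1} (\<lambda>t. G (Re z + t * Im z))" for z
  define A where "A z = integral {0..1} (\<lambda>t. g (Re z + t * Im z))" for z
  define B where "B z = integral {0..1} (\<lambda>t. t * g (Re z + t * Im z))" for z
  have contG: "continuous_on UNIV G"
    by (intro continuous_at_imp_continuous_on ballI DERIV_isCont[OF G])
  have cg: "continuous_on S (\<lambda>x. g (u x))" if "continuous_on S u" for S :: "'z::topological_space set" and u
    by (rule continuous_on_compose2[OF g(1) that]) auto
  have int: "(\<lambda>t. g (x + t * y)) integrable_on {a..b}" "(\<lambda>t. t * g (x + t * y)) integrable_on {a..b}" for x y a b
    by (intro integrable_continuous_interval continuous_intros cg)+
  have contA: "continuous_on UNIV A" and contB: "continuous_on UNIV B"
    unfolding A_def B_def box_real(2)[symmetric]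
    by (intro integral_continuous_on_param; simp only: case_prod_unfold; intro continuous_intros cg)+
  \<comment> \<open>\<open>leibniz_rule\<close> wants the derivative as a continuous function into
    the space of bounded linear maps.\<close>
  define bR where "bR = Blinfun Re"
  define bI where "bI = Blinfun Im"
  have bRI: "blinfun_apply bR = Re" "blinfun_apply bI = Im"
    unfolding bR_def bI_def by (simp_all add: bounded_linear_Blinfun_apply bounded_linear_Re bounded_linear_Im)
  have d\<alpha>: "(\<alpha> has_derivative (\<lambda>v. Re v * A z + Im v * B z)) (at z)" for z
  proof -
    let ?fx = "\<lambda>z t. g (Re z + t * Im z) *\<^sub>R (bR + t *\<^sub>R bI)"
    have c': "continuous_on (UNIV \<times> cbox 0 1) (\<lambda>(z, t). ?fx z t)"
      unfolding case_prod_unfold by (intro continuous_intros cg)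
    have "((\<lambda>z. integral (cbox 0 1) (\<lambda>t. G (Re z + t * Im z))) has_derivative
        blinfun_apply (integral (cbox 0 1) (?fx z))) (at z within UNIV)"
    proof (rule leibniz_rule[OF _ _ c'])
      fix z :: complex and t :: real
      have "((\<lambda>z. Re z + t * Im z) has_derivative (\<lambda>v. Re v + t * Im v)) (at z)"
        by (auto intro!: derivative_eq_intros)
      from has_derivative_compose[OF this G[unfolded has_field_derivative_def]]
      show "((\<lambda>z. G (Re z + t * Im z)) has_derivative blinfun_apply (?fx z t)) (at z within UNIV)"
        by (simp add: blinfun.bilinear_simps bRI o_def fun_eq_iff[symmetric] eta_contract_eq
            has_derivative_eq_rhs[OF _ ext])
      show "(\<lambda>t. G (Re z + t * Im z)) integrable_on cbox 0 1"
        by (intro integrable_continuous continuous_on_compose2[OF contG] continuous_intros) auto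
    qed auto
    moreover have "blinfun_apply (integral (cbox 0 1) (?fx z)) = (\<lambda>v. Re v * A z + Im v * B z)"
    proof
      fix v
      have "blinfun_apply (integral (cbox 0 1) (?fx z)) v = integral (cbox 0 1) (\<lambda>t. blinfun_apply (?fx z t) v)"
        by (rule blinfun_apply_integral) (intro integrable_continuous continuous_intros cg)
      also have "\<dots> = integral {0..1} (\<lambda>t. Re v * g (Re z + t * Im z) + Im v * (t * g (Re z + t * Im z)))"
        by (simp add: blinfun.bilinear_simps bRI algebra_simps)
      also have "\<dots> = Re v * A z + Im v * B z"
        unfolding A_def B_def
        by (intro integral_unique has_integral_add has_integral_mult_right integrable_integral int)
      finally show "blinfun_apply (integral (cbox 0 1) (?fx z)) v = Re v * A z + Im v * B z" .
    qed
    ultimately show ?thesis by (simp add: \<alpha>_def[abs_def])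
  qed
  have FTC: "Im z * integral {a..b} (\<lambda>t. g (Re z + t * Im z)) = G (Re z + b * Im z) - G (Re z + a * Im z)"
    if "a \<le> b" for a b z
  proof -
    have "((\<lambda>t. Im z * g (Re z + t * Im z)) has_integral (G (Re z + b * Im z) - G (Re z + a * Im z))) {a..b}"
    proof (rule fundamental_theorem_of_calculus[OF that])
      fix t
      have "((\<lambda>t. G (Re z + t * Im z)) has_real_derivative g (Re z + t * Im z) * Im z) (at t within {a..b})"
        by (rule DERIV_chain2[OF G]) (auto intro!: derivative_eq_intros)
      then show "((\<lambda>t. G (Re z + t * Im z)) has_vector_derivative Im z * g (Re z + t * Im z)) (at t within {a..b})"
        by (simp add: has_real_derivative_iff_has_vector_derivative mult.commute)
    qed
    then show ?thesis by (simp add: integral_unique flip: integral_mult_right)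
  qed
  \<comment> \<open>Doubling at 0 with y = 1 and y = -1 bounds each of two positive increments by
    \<open>c\<close> times the other.\<close>
  have c1: "1 \<le> c"
  proof (rule ccontr)
    assume "\<not> 1 \<le> c"
    then have c1: "c < 1" by simp
    define a b where "a = G 1 - G 0" and "b = G 0 - G (-1)"
    have "G 0 < G 1" by (rule DERIV_pos_imp_increasing) (use G g in auto)
    moreover have "G (-1) < G 0" by (rule DERIV_pos_imp_increasing) (use G g in auto)
    ultimately have ab: "0 < a" "0 < b" "a \<le> c * b" "b \<le> c * a"
      using c[of 0 1] c[of 0 "-1"] by (simp_all add: a_def b_def)
    have "c * b < 1 * b" "c * a < 1 * a"
      using c1 ab by (intro mult_strict_right_mono; simp)+
    then show False using ab by linarith
  qed
  then have c0: "0 \<le> c" by simp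
  \<comment> \<open>\<open>Q\<close> is the part of \<open>A\<close> coming from t in [1/2, 1].
    There t is at least 1/2, so \<open>Q\<close> is at most \<open>2 * B\<close>; and doubling at Re
    z + Im z / 2 bounds the remaining half of \<open>A\<close> by \<open>c * Q\<close>. This bounds
    \<open>A\<close> by a multiple of \<open>B\<close>.\<close>
  define Q where "Q z = integral {1/2..1} (\<lambda>t. g (Re z + t * Im z))" for z
  have Q0: "0 < Q z" for z
  proof -
    have "integral {1/2..1} (\<lambda>t::real. 0) < Q z"
      unfolding Q_def using g(2) by (intro integral_less_real continuous_intros cg) auto
    then show ?thesis by simp
  qed
  have BQ: "Q z / 2 \<le> B z" for z
  proof -
    have "B z = integral {0..1/2} (\<lambda>t. t * g (Re z + t * Im z)) + integral {1/2..1} (\<lambda>t. t * g (Re z + t * Im z))"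
      unfolding B_def using int by (intro Henstock_Kurzweil_Integration.integral_combine[symmetric]) auto
    moreover have "0 \<le> integral {0..1/2} (\<lambda>t. t * g (Re z + t * Im z))"
      using less_imp_le[OF g(2)] by (intro integral_nonneg int) auto
    moreover have "integral {1/2..1} (\<lambda>t. 1 / 2 * g (Re z + t * Im z)) \<le> integral {1/2..1} (\<lambda>t. t * g (Re z + t * Im z))"
      using less_imp_le[OF g(2)] by (intro integral_le int integrable_on_mult_right mult_right_mono) auto
    ultimately show ?thesis by (simp add: Q_def)
  qed
  have A_at_real: "A z = g (Re z)" "Q z = g (Re z) / 2" if "Im z = 0" for z
    using that by (simp_all add: A_def Q_def)
  have scale: "\<bar>a / y\<bar> \<le> c * \<bar>b / y\<bar>" if "\<bar>a\<bar> \<le> c * \<bar>b\<bar>" for a b y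
    using divide_right_mono[OF that, of "\<bar>y\<bar>"] by (simp add: abs_divide)
  have AQ: "A z \<le> (1 + c) * Q z" for z
  proof (cases "Im z = 0")
    case True
    then have "A z = 2 * Q z" using A_at_real[of z] by simp
    also have "\<dots> \<le> (1 + c) * Q z" using c1 Q0[of z] by (intro mult_right_mono) auto
    finally show ?thesis .
  next
    case False
    have Az: "A z = (G (Re z + Im z) - G (Re z)) / Im z"
      using FTC[of 0 1 z] False by (simp add: A_def field_simps)
    have Qz: "Q z = (G (Re z + Im z) - G (Re z + Im z / 2)) / Im z"
      using FTC[of "1/2" 1 z] False by (simp add: Q_def field_simps)
    define R where "R = (G (Re z + Im z / 2) - G (Re z)) / Im z"
    have "\<bar>G (Re z + Im z / 2) - G (Re z)\<bar> \<le> c * \<bar>G (Re z + Im z) - G (Re z + Im z / 2)\<bar>"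
      using c[of "Re z + Im z / 2" "- (Im z / 2)"] by (simp add: abs_minus_commute add.commute[of "Im z"])
    then have "\<bar>R\<bar> \<le> c * \<bar>Q z\<bar>"
      unfolding R_def Qz by (rule scale)
    moreover have "A z = R + Q z"
      by (simp add: Az Qz R_def diff_divide_distrib)
    ultimately show ?thesis using Q0[of z] by (simp add: algebra_simps)
  qed
  have Apos: "0 < A z" for z
  proof -
    have "integral {0..1} (\<lambda>t::real. 0) < A z"
      unfolding A_def using g(2) by (intro integral_less_real continuous_intros cg) auto
    then show ?thesis by simp
  qed
  have Bpos: "0 < B z" for z using BQ[of z] Q0[of z] by linarith
  have Acnj: "A z \<le> c * A (cnj z)" for z
  proof (cases "Im z = 0")
    case True
    then have "A z = 1 * A (cnj z)" "0 < A (cnj z)"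
      using A_at_real(1)[of z] A_at_real(1)[of "cnj z"] g(2) by simp_all
    then show ?thesis using mult_right_mono[OF c1, of "A (cnj z)"] by linarith
  next
    case False
    have "A z = (G (Re z + Im z) - G (Re z)) / Im z" "A (cnj z) = (G (Re z) - G (Re z - Im z)) / Im z"
      using FTC[of 0 1 z] FTC[of 0 1 "cnj z"] False by (simp_all add: A_def field_simps)
    then have "\<bar>A z\<bar> \<le> c * \<bar>A (cnj z)\<bar>"
      using scale[OF c[of "Re z" "Im z"], of "Im z"] by simp
    then show ?thesis using Apos[of z] Apos[of "cnj z"] by simp
  qed
  have AB: "A z \<le> 2 * (1 + c) * B z" for z
  proof -
    have "A z \<le> (1 + c) * Q z" by (rule AQ)
    also have "\<dots> \<le> (1 + c) * (2 * B z)" using BQ[of z] c0 by (intro mult_left_mono) auto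
    finally show ?thesis by (simp add: algebra_simps)
  qed
  define \<Phi> where "\<Phi> z = Complex ((\<alpha> z + \<alpha> (cnj z)) / 2) ((\<alpha> z - \<alpha> (cnj z)) / 2)" for z
  define \<Phi>' where "\<Phi>' z v = Complex ((Re v * (A z + A (cnj z)) + Im v * (B z - B (cnj z))) / 2)
     ((Re v * (A z - A (cnj z)) + Im v * (B z + B (cnj z))) / 2)" for z v
  have d\<alpha>cnj: "((\<lambda>z. \<alpha> (cnj z)) has_derivative (\<lambda>v. Re v * A (cnj z) - Im v * B (cnj z))) (at z)" for z
    using has_derivative_compose[OF bounded_linear_imp_has_derivative[OF bounded_linear_cnj] d\<alpha>, of z] by simp
  have d\<Phi>: "(\<Phi> has_derivative \<Phi>' z) (at z)" for z
  proof -
    have "((\<lambda>z. of_real ((\<alpha> z + \<alpha> (cnj z)) / 2) + \<i> * of_real ((\<alpha> z - \<alpha> (cnj z)) / 2)) has_derivative \<Phi>' z) (at z)"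
      by (rule derivative_eq_intros d\<alpha> d\<alpha>cnj refl | simp)+
         (simp add: \<Phi>'_def complex_eq_iff fun_eq_iff algebra_simps)
    then show ?thesis unfolding \<Phi>_def[abs_def] Complex_eq .
  qed
  have "continuous_on UNIV (\<lambda>z. \<Phi>' z v)" for v
  proof -
    have *: "continuous_on UNIV (\<lambda>z. A (cnj z))" "continuous_on UNIV (\<lambda>z. B (cnj z))"
      by (rule continuous_on_compose2[OF contA] continuous_on_compose2[OF contB]; auto intro: continuous_intros)+
    show ?thesis
      unfolding \<Phi>'_def Complex_eq by (intro continuous_intros contA contB *) auto
  qed
  moreover have "0 < jac_det (\<Phi>' z) \<and> hs_norm2 (\<Phi>' z) \<le> 4 * c * (1 + c) * jac_det (\<Phi>' z)" for z
  proof -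
    \<comment> \<open>The Jacobian is (a b' + a' b) / 2 and \<open>hs_norm2\<close> is at most a^2 +
      a'^2. Comparing a with a' turns the latter into 2 c a a', and comparing \<open>A\<close> with
      \<open>B\<close> turns a a' into the two terms of the Jacobian.\<close>
    define a a' b b' where ab: "a = A z" "a' = A (cnj z)" "b = B z" "b' = B (cnj z)"
    have pos: "0 < a" "0 < a'" "0 < b" "0 < b'" using Apos Bpos by (auto simp: ab)
    have J: "jac_det (\<Phi>' z) = (a * b' + a' * b) / 2"
      by (simp add: jac_det_def \<Phi>'_def ab[symmetric] field_simps)
    have H: "hs_norm2 (\<Phi>' z) = (a\<^sup>2 + a'\<^sup>2 + b\<^sup>2 + b'\<^sup>2) / 2"
      unfolding hs_norm2_def cmod_power2 by (simp add: \<Phi>'_def ab[symmetric] power2_eq_square field_simps)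
    have BA: "B w \<le> A w" for w
      unfolding A_def B_def using less_imp_le[OF g(2)]
      by (intro integral_le int mult_left_le_one_le) auto
    have "b\<^sup>2 \<le> a\<^sup>2" "b'\<^sup>2 \<le> a'\<^sup>2" using BA pos by (auto simp: ab intro!: power_mono)
    then have "hs_norm2 (\<Phi>' z) \<le> a\<^sup>2 + a'\<^sup>2" by (simp add: H)
    also have "\<dots> \<le> c * (a * a') + c * (a * a')"
    proof -
      have "a * a \<le> a * (c * a')" "a' * a' \<le> a' * (c * a)"
        using Acnj[of z] Acnj[of "cnj z"] pos by (simp_all add: ab[symmetric])
      then show ?thesis by (simp add: power2_eq_square algebra_simps)
    qed
    also have "\<dots> \<le> 4 * c * (1 + c) * jac_det (\<Phi>' z)"
    proof -
      have "a * a' \<le> a * (2 * (1 + c) * b')" "a' * a \<le> a' * (2 * (1 + c) * b)"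
        using AB[of z] AB[of "cnj z"] pos by (auto simp: ab[symmetric])
      then have "a * a' + a * a' \<le> 4 * (1 + c) * jac_det (\<Phi>' z)"
        by (simp add: J algebra_simps)
      from mult_left_mono[OF this c0] show ?thesis by (simp add: algebra_simps)
    qed
    finally show ?thesis using pos by (simp add: J add_pos_pos)
  qed
  moreover have "inj \<Phi>"
  proof (rule injI)
    fix z w assume "\<Phi> z = \<Phi> w"
    then have eq: "\<alpha> z = \<alpha> w" "\<alpha> (cnj z) = \<alpha> (cnj w)"
      by (auto simp: \<Phi>_def field_simps)
    have mx: "\<alpha> (Complex x y) < \<alpha> (Complex x' y)" if "x < x'" for x x' y
    proof (rule DERIV_pos_imp_increasing[OF that])
      fix x
      have "((\<lambda>x. Complex x y) has_derivative of_real) (at x)"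
        unfolding Complex_eq by (auto intro!: derivative_eq_intros)
      from has_derivative_compose[OF this d\<alpha>]
      have "((\<lambda>x. \<alpha> (Complex x y)) has_real_derivative A (Complex x y)) (at x)"
        unfolding has_field_derivative_def by (rule has_derivative_eq_rhs) (simp add: fun_eq_iff)
      then show "\<exists>d. ((\<lambda>x. \<alpha> (Complex x y)) has_real_derivative d) (at x) \<and> 0 < d" using Apos by blast
    qed
    have my: "\<alpha> (Complex x y) < \<alpha> (Complex x y')" if "y < y'" for x y y'
    proof (rule DERIV_pos_imp_increasing[OF that])
      fix y
      have "((\<lambda>y. Complex x y) has_derivative (\<lambda>v. \<i> * of_real v)) (at y)"
        unfolding Complex_eq by (auto intro!: derivative_eq_intros)
      from has_derivative_compose[OF this d\<alpha>]
      have "((\<lambda>y. \<alpha> (Complex x y)) has_real_derivative B (Complex x y)) (at y)"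
        unfolding has_field_derivative_def by (rule has_derivative_eq_rhs) (simp add: fun_eq_iff)
      then show "\<exists>d. ((\<lambda>y. \<alpha> (Complex x y)) has_real_derivative d) (at y) \<and> 0 < d" using Bpos by blast
    qed
    have le: "\<alpha> (Complex x y) \<le> \<alpha> (Complex x' y')" if "x \<le> x'" "y \<le> y'" for x x' y y'
      using mx[of x x' y] my[of y y' x'] that by (cases "x = x'"; cases "y = y'"; force)
    \<comment> \<open>If x < x', equality of \<alpha> at the two points forces y > y', since
      \<alpha> increases in both variables; equality at the conjugates forces -y > -y'.\<close>
    have no: False if "\<alpha> (Complex x y) = \<alpha> (Complex x' y')" "\<alpha> (Complex x (-y)) = \<alpha> (Complex x' (-y'))" "x < x'"
      for x x' y y'
    proof (cases "y \<le> y'")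
      case True
      then show False using mx[OF that(3), of y] le[of x' x' y y'] that by simp
    next
      case False
      then show False using mx[OF that(3), of "-y"] le[of x' x' "-y" "-y'"] that by simp
    qed
    obtain x y x' y' where zw: "z = Complex x y" "w = Complex x' y'" by (metis complex.exhaust)
    have "x = x'" using no[of x y x' y'] no[of x' y' x y] eq
      by (cases x x' rule: linorder_cases) (simp_all add: zw complex_cnj)
    moreover have "y = y'"
      using my[of y y' x] my[of y' y x] eq(1) \<open>x = x'\<close>
      by (cases y y' rule: linorder_cases) (simp_all add: zw)
    ultimately show "z = w" by (simp add: zw)
  qed
  ultimately have "C1_qc (4 * c * (1 + c)) \<Phi>"
    unfolding C1_qc_def using d\<Phi> by (intro conjI exI[of _ \<Phi>']) auto
  moreover have "\<Phi> (of_real x) = of_real (G x)" for x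
    by (simp add: \<Phi>_def \<alpha>_def complex_eq_iff)
  ultimately show ?thesis using that by blast
qed

section \<open>Quasisymmetric sequences\<close>

text \<open>The hypothesis is the trapezoid rule, exact for the linear interpolation of
  \<open>a\<close>; it lets the antiderivative take the prescribed values \<open>b\<close> at all
  integers at once.\<close>

lemma piecewise_linear_antiderivative:
  fixes a b :: "int \<Rightarrow> real"
  assumes ab: "\<And>n. b (n + 1) - b n = (a n + a (n + 1)) / 2"
  obtains G g where "\<And>x. (G has_real_derivative g x) (at x)" "continuous_on UNIV g"
    "\<And>n. G (of_int n) = b n"
    "\<And>n x. of_int n \<le> x \<Longrightarrow> x \<le> of_int n + 1 \<Longrightarrow> min (a n) (a (n + 1)) \<le> g x \<and> g x \<le> max (a n) (a (n + 1))"
proof -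
  define g where "g x = a \<lfloor>x\<rfloor> + (x - of_int \<lfloor>x\<rfloor>) * (a (\<lfloor>x\<rfloor> + 1) - a \<lfloor>x\<rfloor>)" for x :: real
  have g_eq: "g x = a n + (x - of_int n) * (a (n + 1) - a n)" if "of_int n \<le> x" "x \<le> of_int n + 1" for n x
  proof (cases "x = of_int n + 1")
    case True
    then have "\<lfloor>x\<rfloor> = n + 1" by linarith
    then show ?thesis using True by (simp add: g_def)
  next
    case False
    then have "\<lfloor>x\<rfloor> = n" using that by linarith
    then show ?thesis by (simp add: g_def)
  qed
  have isCont_g: "isCont g x" for x
  proof -
    define n where "n = \<lceil>x\<rceil>"
    \<comment> \<open>With n the ceiling of x, this single continuous formula covers both linear
      pieces that meet at n.\<close>
    let ?f = "\<lambda>y. a n + max 0 (y - of_int n) * (a (n + 1) - a n) + min 0 (y - of_int n) * (a n - a (n - 1))"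
    have x: "x \<in> {of_int n - 1<..<of_int n + 1}" unfolding n_def by simp linarith
    have eq: "?f y = g y" if "y \<in> {of_int n - 1<..<of_int n + 1}" for y
      using that g_eq[of n y] g_eq[of "n - 1" y]
      by (cases "of_int n \<le> y") (auto simp: min_def max_def algebra_simps)
    have "\<forall>\<^sub>F y in nhds x. y \<in> {of_int n - 1<..<of_int n + 1}"
      using x by (intro eventually_nhds_in_open) auto
    then have "\<forall>\<^sub>F y in nhds x. ?f y = g y"
      by (rule eventually_mono) (rule eq)
    moreover have "isCont ?f x" by (intro continuous_intros)
    ultimately show ?thesis using isCont_cong[of ?f g x] by simp
  qed
  obtain H where H: "\<And>x. (H has_real_derivative g x) (at x)"
    using einterval_antiderivative[of "-\<infinity>" "\<infinity>" g] isCont_g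
    by (auto simp: has_real_derivative_iff_has_vector_derivative)
  define G where "G x = H x + (b 0 - H 0)" for x
  have G: "(G has_real_derivative g x) (at x)" for x
    unfolding G_def using DERIV_add[OF H DERIV_const] by simp
  have step: "G (of_int n + 1) - G (of_int n) = (a n + a (n + 1)) / 2" for n
  proof -
    let ?q = "\<lambda>x. G x - (a n * (x - of_int n) + (a (n + 1) - a n) * (x - of_int n)\<^sup>2 / 2)"
    have d: "(?q has_real_derivative g x - (a n + (x - of_int n) * (a (n + 1) - a n))) (at x)" for x
      by (rule derivative_eq_intros G refl | simp add: field_simps)+
    have "?q (of_int n + 1) = ?q (of_int n)"
    proof (rule DERIV_isconst_end[where f = ?q])
      show "continuous_on {of_int n..of_int n + 1} ?q"
        by (intro continuous_at_imp_continuous_on ballI DERIV_isCont[OF d])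
      show "(?q has_real_derivative 0) (at x)" if "of_int n < x" "x < of_int n + 1" for x
        using d[of x] g_eq[of n x] that by simp
    qed simp
    then show ?thesis by (simp add: field_simps)
  qed
  have Gb: "G (of_int n) = b n" for n
  proof (induction n rule: int_induct[where k = 0])
    case base
    show ?case by (simp add: G_def)
  next
    case (step1 i)
    then show ?case using step[of i] ab[of i] by simp
  next
    case (step2 i)
    then show ?case using step[of "i - 1"] ab[of "i - 1"] by simp
  qed
  have bounds: "min (a n) (a (n + 1)) \<le> g x \<and> g x \<le> max (a n) (a (n + 1))"
    if "of_int n \<le> x" "x \<le> of_int n + 1" for n x
  proof -
    define t where "t = x - of_int n"
    have t: "0 \<le> t" "t \<le> 1" using that by (auto simp: t_def)
    have "g x = (1 - t) * a n + t * a (n + 1)"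
      using g_eq[OF that] by (simp add: t_def algebra_simps)
    moreover have "(1 - t) * min (a n) (a (n + 1)) \<le> (1 - t) * a n" "t * min (a n) (a (n + 1)) \<le> t * a (n + 1)"
      "(1 - t) * a n \<le> (1 - t) * max (a n) (a (n + 1))" "t * a (n + 1) \<le> t * max (a n) (a (n + 1))"
      using t by (auto intro!: mult_left_mono)
    ultimately show ?thesis by (simp add: algebra_simps)
  qed
  show ?thesis
    using that[OF G _ Gb bounds] isCont_g continuous_at_imp_continuous_on by blast
qed

section \<open>Quasisymmetry on the integers and coarse monotonicity\<close>

locale qs_seq =
  fixes \<eta> :: "real \<Rightarrow> real" and r :: "int \<Rightarrow> real"
  assumes mono: "\<And>s t. 0 \<le> s \<Longrightarrow> s \<le> t \<Longrightarrow> \<eta> s \<le> \<eta> t"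
    and inj: "inj r"
    and qs: "\<And>x y z. x \<noteq> z \<Longrightarrow>
      \<bar>r x - r y\<bar> \<le> \<eta> (\<bar>of_int (x - y)\<bar> / \<bar>of_int (x - z)\<bar>) * \<bar>r x - r z\<bar>"
begin

lemma qs_bound:
  assumes "x \<noteq> z" "\<bar>real_of_int (x - y)\<bar> \<le> t * \<bar>of_int (x - z)\<bar>"
  shows "\<bar>r x - r y\<bar> \<le> \<eta> t * \<bar>r x - r z\<bar>"
proof -
  have "\<bar>real_of_int (x - y)\<bar> / \<bar>of_int (x - z)\<bar> \<le> t"
    using assms by (simp add: divide_le_eq)
  then show ?thesis
    using qs[OF assms(1), of y] mono by (meson abs_ge_zero divide_nonneg_nonneg mult_right_mono order_trans)
qed

lemma r_eq_iff [simp]: "r x = r y \<longleftrightarrow> x = y"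
  using inj by (auto dest: injD)

text \<open>The step from 0 to 1 is compared with itself.\<close>

lemma \<eta>_ge_1: "1 \<le> t \<Longrightarrow> 1 \<le> \<eta> t"
  using qs_bound[of 0 1 1 t] by simp

lemma \<eta>_nonneg: "0 \<le> t \<Longrightarrow> 0 \<le> \<eta> t"
  using qs_bound[of 0 1 0 t] by (simp add: zero_le_mult_iff)

lemma coarsely_monotone:
  assumes M: "1 \<le> M" "\<eta> (1 / real_of_int M) < 1"
  shows "(\<forall>n m. n + M \<le> m \<longrightarrow> r n < r m) \<or> (\<forall>n m. n + M \<le> m \<longrightarrow> r m < r n)"
proof -
  \<comment> \<open>A single step is too short to cross the value at a point at distance at least \<open>M\<close>.\<close>
  have near: "r x < r z \<longleftrightarrow> r x < r z'" "r z < r x \<longleftrightarrow> r z' < r x"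
    if "M \<le> \<bar>z - x\<bar>" "\<bar>z' - z\<bar> = 1" for x z z'
  proof -
    have ne: "z \<noteq> x" using that M by auto
    have "real_of_int M \<le> real_of_int \<bar>z - x\<bar>" using that by (simp only: of_int_le_iff)
    then have "\<bar>real_of_int (z - z')\<bar> \<le> 1 / real_of_int M * \<bar>of_int (z - x)\<bar>"
      using that M by (simp add: abs_minus_commute field_simps flip: of_int_diff of_int_abs)
    then have "\<bar>r z - r z'\<bar> \<le> \<eta> (1 / real_of_int M) * \<bar>r z - r x\<bar>"
      by (rule qs_bound[OF ne])
    also have "\<dots> < 1 * \<bar>r z - r x\<bar>" using M ne by (intro mult_strict_right_mono) auto
    finally show "r x < r z \<longleftrightarrow> r x < r z'" "r z < r x \<longleftrightarrow> r z' < r x" by auto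
  qed
  have right: "r n < r m \<longleftrightarrow> r n < r (n + M)" if "n + M \<le> m" for n m
    using that
  proof (induction m rule: int_ge_induct)
    case (step i)
    then show ?case using near(1)[of i n "i + 1"] by simp
  qed simp
  have left: "r n < r m \<longleftrightarrow> r (m - M) < r m" if "n \<le> m - M" for n m
    using that
  proof (induction n rule: int_le_induct)
    case (step i)
    then show ?case using near(2)[of i m "i - 1"] by simp
  qed simp
  \<comment> \<open>\<open>right\<close> moves the right end of a pair and \<open>left\<close> the
    left end; any pair is linked to (0, M) through the common right end
    \<open>max m M\<close>.\<close>
  have "r n < r m \<longleftrightarrow> r 0 < r M" if "n + M \<le> m" for n m
    using right[of n m] right[of n "max m M"] left[of n "max m M"] left[of 0 "max m M"]
      right[of 0 "max m M"] that by (simp add: le_max_iff_disj)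
  moreover have "n \<noteq> m" if "n + M \<le> m" for n m using that M by auto
  ultimately show ?thesis by (metis linorder_neqE r_eq_iff)
qed

end

section \<open>Averages of a coarsely increasing sequence\<close>

definition shift_const :: "(real \<Rightarrow> real) \<Rightarrow> nat \<Rightarrow> real" where
  "shift_const \<eta> i = 2 * \<eta> (real i + 1)"

locale qs_seq_increasing = qs_seq +
  fixes M :: nat
  assumes M: "1 \<le> M" and inc: "\<And>n m. n + int M \<le> m \<Longrightarrow> r n < r m"
begin

abbreviation \<Lambda> :: "nat \<Rightarrow> real" where
  "\<Lambda> \<equiv> shift_const \<eta>"

lemma \<Lambda>_ge_2: "2 \<le> \<Lambda> i"
  using \<eta>_ge_1[of "real i + 1"] by (simp add: shift_const_def)

lemma \<Lambda>_mono: "i \<le> j \<Longrightarrow> \<Lambda> i \<le> \<Lambda> j"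
  by (simp add: shift_const_def mono)

text \<open>Both n + i and n + i + k lie within (j + 1) |k| of n. Comparing their distances to n
  with the step from n to n + k and adding gives the 2 \<eta>(j + 1) of \<open>shift_const\<close>,
  which mentions \<eta> only and so is available before any sequence is given.\<close>

lemma increment_shift:
  assumes "k \<noteq> 0" "\<bar>i\<bar> \<le> int j"
  shows "\<bar>r (n + i + k) - r (n + i)\<bar> \<le> \<Lambda> j * \<bar>r (n + k) - r n\<bar>"
proof -
  have k: "1 \<le> real_of_int \<bar>k\<bar>" using assms by linarith
  have j: "real_of_int \<bar>i\<bar> \<le> real j" using assms by linarith
  have ik: "real_of_int \<bar>i + k\<bar> \<le> real_of_int \<bar>i\<bar> + real_of_int \<bar>k\<bar>" by linarith
  have jk: "real j * 1 \<le> real j * real_of_int \<bar>k\<bar>" using k by (intro mult_left_mono) auto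
  have "\<bar>r n - r (n + i + k)\<bar> \<le> \<eta> (real j + 1) * \<bar>r n - r (n + k)\<bar>"
    by (rule qs_bound) (use assms ik j jk in \<open>auto simp: algebra_simps\<close>)
  moreover have "\<bar>r n - r (n + i)\<bar> \<le> \<eta> (real j + 1) * \<bar>r n - r (n + k)\<bar>"
    by (rule qs_bound) (use assms k j jk in \<open>auto simp: algebra_simps\<close>)
  ultimately show ?thesis by (simp add: shift_const_def abs_minus_commute)
qed

text \<open>Steps of length \<open>M\<close> are the shortest ones whose sign \<open>inc\<close>
  guarantees; a single increment may be negative.\<close>

definition slope :: "int \<Rightarrow> real" where
  "slope n = (r (n + int M) - r n) / real M"

lemma slope_pos: "0 < slope n"
  using M inc[of n "n + int M"] by (simp add: slope_def)

lemma slope_shift: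
  assumes "\<bar>i\<bar> \<le> int j"
  shows "slope (n + i) \<le> \<Lambda> j * slope n"
proof -
  have "r (n + i + int M) - r (n + i) \<le> \<Lambda> j * (r (n + int M) - r n)"
    using increment_shift[of "int M" i j n] assms M inc[of n "n + int M"] by simp
  then show ?thesis using divide_right_mono[of _ _ "real M"] by (simp add: slope_def)
qed

text \<open>The two ends r(n) and r(n + M) carry half weight, so that increments telescope to the
  trapezoid values of \<open>slope\<close>, which \<open>piecewise_linear_antiderivative\<close>
  requires.\<close>

definition avg :: "int \<Rightarrow> real" where
  "avg n = (\<Sum>i<M. r (n + int i) + r (n + int i + 1)) / (2 * real M)"

lemma avg_step: "avg (n + 1) - avg n = (slope n + slope (n + 1)) / 2"
proof -
  have tel: "(\<Sum>i<M. r (m + int i + 1) - r (m + int i)) = r (m + int M) - r m" for m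
    using sum_lessThan_telescope[of "\<lambda>i. r (m + int i)" M] by (simp add: add_ac)
  have "(\<Sum>i<M. r (n + 1 + int i) + r (n + 1 + int i + 1)) - (\<Sum>i<M. r (n + int i) + r (n + int i + 1))
     = (\<Sum>i<M. r (n + int i + 1) - r (n + int i)) + (\<Sum>i<M. r (n + 1 + int i + 1) - r (n + 1 + int i))"
    by (simp add: sum.distrib[symmetric] sum_subtractf[symmetric] add_ac)
  also have "\<dots> = (r (n + int M) - r n) + (r (n + 1 + int M) - r (n + 1))"
    by (simp only: tel)
  finally have "avg (n + 1) - avg n = ((r (n + int M) - r n) + (r (n + 1 + int M) - r (n + 1))) / (2 * real M)"
    by (simp add: avg_def flip: diff_divide_distrib)
  then show ?thesis by (simp add: slope_def mult.commute flip: add_divide_distrib)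
qed

lemma avg_diff:
  "avg (n + k) - avg n = (\<Sum>i<M. (r (n + int i + k) - r (n + int i)) +
     (r (n + int (Suc i) + k) - r (n + int (Suc i)))) / (2 * real M)"
  by (simp add: avg_def sum_subtractf[symmetric] add_ac flip: diff_divide_distrib)
     (simp add: algebra_simps)

lemma avg_upper:
  assumes "k \<noteq> 0"
  shows "\<bar>avg (n + k) - avg n\<bar> \<le> \<Lambda> M * \<bar>r (n + k) - r n\<bar>"
proof -
  let ?t = "\<lambda>i. r (n + int i + k) - r (n + int i)"
  have t: "\<bar>?t i\<bar> \<le> \<Lambda> M * \<bar>r (n + k) - r n\<bar>" if "i \<le> M" for i
    using increment_shift[OF assms, of "int i" M n] that by simp
  have "\<bar>\<Sum>i<M. ?t i + ?t (Suc i)\<bar> \<le> (\<Sum>i<M. 2 * (\<Lambda> M * \<bar>r (n + k) - r n\<bar>))"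
  proof (rule order_trans[OF sum_abs sum_mono])
    fix i assume "i \<in> {..<M}"
    then show "\<bar>?t i + ?t (Suc i)\<bar> \<le> 2 * (\<Lambda> M * \<bar>r (n + k) - r n\<bar>)"
      using t[of i] t[of "Suc i"] by simp
  qed
  then show ?thesis
    using M unfolding avg_diff by (simp add: abs_divide divide_le_eq mult_ac)
qed

text \<open>For k at least M all terms of \<open>avg_diff\<close> are positive, so nothing cancels,
  and shifting back by i compares each with the step at n. For shorter steps terms of both signs may
  occur. Negative k exchanges the end points.\<close>

lemma avg_lower:
  assumes "int M \<le> \<bar>k\<bar>"
  shows "\<bar>r (n + k) - r n\<bar> \<le> \<Lambda> M * \<bar>avg (n + k) - avg n\<bar>"
proof -
  have pos: "r (n + k) - r n \<le> \<Lambda> M * (avg (n + k) - avg n) \<and> r n < r (n + k)" if k: "int M \<le> k" for n k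
  proof
    let ?t = "\<lambda>i. r (n + int i + k) - r (n + int i)"
    have t: "r (n + k) - r n \<le> \<Lambda> M * ?t i" if "i \<le> M" for i
      using increment_shift[of k "- int i" M "n + int i"] that k M inc[of "n + int i" "n + int i + k"] by simp
    have "(\<Sum>i<M. 2 * (r (n + k) - r n)) \<le> (\<Sum>i<M. \<Lambda> M * (?t i + ?t (Suc i)))"
    proof (rule sum_mono)
      fix i assume "i \<in> {..<M}"
      then show "2 * (r (n + k) - r n) \<le> \<Lambda> M * (?t i + ?t (Suc i))"
        using t[of i] t[of "Suc i"] by (simp add: algebra_simps)
    qed
    also have "\<dots> = \<Lambda> M * (\<Sum>i<M. ?t i + ?t (Suc i))" by (rule sum_distrib_left[symmetric])
    finally show "r (n + k) - r n \<le> \<Lambda> M * (avg (n + k) - avg n)"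
      using M unfolding avg_diff by (simp add: le_divide_eq mult_ac)
    show "r n < r (n + k)" using inc k by simp
  qed
  have "0 \<le> \<Lambda> M" using \<Lambda>_ge_2[of M] by simp
  then have *: "\<bar>r (n + k) - r n\<bar> \<le> \<Lambda> M * \<bar>avg (n + k) - avg n\<bar>" if "int M \<le> k" for n k
    using pos[OF that, of n] mult_left_mono[OF abs_ge_self[of "avg (n + k) - avg n"], of "\<Lambda> M"] by linarith
  show ?thesis
    using *[of k n] *[of "- k" "n + k"] assms by (cases "0 \<le> k") (auto simp: abs_minus_commute)
qed

text \<open>The factor 4 pays for rounding to integers in the doubling estimate: k + 2 is at most 4
  (k - 1) once k is at least 2.\<close>

lemma avg_coarse:
  assumes "int M \<le> \<bar>l\<bar>" "\<bar>j\<bar> \<le> 4 * \<bar>l\<bar>"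
  shows "\<bar>avg (p + j) - avg p\<bar> \<le> (\<Lambda> M)\<^sup>2 * \<eta> 4 * \<bar>avg (p + l) - avg p\<bar>"
proof (cases "j = 0")
  case True
  then show ?thesis using \<eta>_ge_1[of 4] by simp
next
  case False
  have \<Lambda>: "0 \<le> \<Lambda> M" using \<Lambda>_ge_2[of M] by simp
  have l: "l \<noteq> 0" using assms M by auto
  have "real_of_int \<bar>j\<bar> \<le> real_of_int (4 * \<bar>l\<bar>)" using assms by (simp only: of_int_le_iff)
  then have 1: "\<bar>r p - r (p + j)\<bar> \<le> \<eta> 4 * \<bar>r p - r (p + l)\<bar>"
    using l by (intro qs_bound) auto
  have "\<bar>avg (p + j) - avg p\<bar> \<le> \<Lambda> M * \<bar>r (p + j) - r p\<bar>"
    by (rule avg_upper[OF False])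
  also have "\<dots> \<le> \<Lambda> M * (\<eta> 4 * \<bar>r (p + l) - r p\<bar>)"
    using 1 \<Lambda> by (intro mult_left_mono) (simp_all add: abs_minus_commute)
  also have "\<dots> \<le> \<Lambda> M * (\<eta> 4 * (\<Lambda> M * \<bar>avg (p + l) - avg p\<bar>))"
    using \<Lambda> \<eta>_ge_1[of 4] avg_lower[OF assms(1), of p] by (intro mult_left_mono) auto
  finally show ?thesis by (simp add: power2_eq_square mult_ac)
qed

lemma abs_avg_diff_le:
  assumes "\<And>i. i \<le> M \<Longrightarrow> \<bar>r (n + int i) - r n\<bar> \<le> B"
  shows "\<bar>avg n - r n\<bar> \<le> B"
proof -
  have "avg n - r n = (\<Sum>i<M. (r (n + int i) - r n) + (r (n + int (Suc i)) - r n)) / (2 * real M)"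
    using M by (simp add: avg_def sum.distrib sum_subtractf field_simps)
  also have "\<bar>\<dots>\<bar> \<le> (\<Sum>i<M. 2 * B) / (2 * real M)"
    unfolding abs_divide
  proof (rule frac_le)
    show "\<bar>\<Sum>i<M. (r (n + int i) - r n) + (r (n + int (Suc i)) - r n)\<bar> \<le> (\<Sum>i<M. 2 * B)"
    proof (rule order_trans[OF sum_abs sum_mono])
      fix i assume "i \<in> {..<M}"
      then show "\<bar>(r (n + int i) - r n) + (r (n + int (Suc i)) - r n)\<bar> \<le> 2 * B"
        using assms[of i] assms[of "Suc i"] by simp
    qed
    have "0 \<le> B" using assms[of 0] by simp
    then show "0 \<le> (\<Sum>i<M. 2 * B)" by simp
  qed (use M in auto)
  finally show ?thesis using M by simp
qed

end

section \<open>The doubling homeomorphism and the displacement\<close>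

context qs_seq_increasing
begin

text \<open>The two terms in \<open>c\<close> belong to long and to short intervals. The second
  condition on \<open>D\<close> makes a step of length \<open>D\<close> of \<open>avg\<close> exceed
  the distance from \<open>avg n\<close> to \<open>r n\<close>.\<close>

lemma doubling_interpolation:
  fixes D :: nat
  assumes D: "M \<le> D" "\<eta> (real M / real D) * \<Lambda> M \<le> 1"
  defines "c \<equiv> max ((\<Lambda> M)\<^sup>2 * \<eta> 4) ((\<Lambda> (M + 3))\<^sup>2)"
  obtains G g \<sigma> where "\<And>x. (G has_real_derivative g x) (at x)" "continuous_on UNIV g" "\<And>x. 0 < g x"
    "\<And>x y. \<bar>G (x + y) - G x\<bar> \<le> c * \<bar>G x - G (x - y)\<bar>"
    "\<And>n. G (\<sigma> n) = r n" "\<And>n. \<bar>\<sigma> n - of_int n\<bar> \<le> real D"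
    "\<And>m n. m \<noteq> n \<Longrightarrow> 1 / (\<Lambda> (D + 2) * \<eta> (real M)) \<le> \<bar>\<sigma> m - \<sigma> n\<bar>"
proof -
  obtain G g where G: "\<And>x. (G has_real_derivative g x) (at x)" and cont_g: "continuous_on UNIV g"
    and Gavg: "\<And>n. G (of_int n) = avg n"
    and g_between: "\<And>n x. of_int n \<le> x \<Longrightarrow> x \<le> of_int n + 1 \<Longrightarrow>
      min (slope n) (slope (n + 1)) \<le> g x \<and> g x \<le> max (slope n) (slope (n + 1))"
    using piecewise_linear_antiderivative[where a = slope and b = avg, OF avg_step] by blast
  have \<Lambda>0: "0 < \<Lambda> i" for i using \<Lambda>_ge_2[of i] by simp
  have g_pos: "0 < g x" for x
    using g_between[of "\<lfloor>x\<rfloor>" x] slope_pos[of "\<lfloor>x\<rfloor>"] slope_pos[of "\<lfloor>x\<rfloor> + 1"] by linarith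
  \<comment> \<open>\<open>i + 1\<close> covers both ends of the unit interval containing
    \<open>x\<close>, between whose slopes \<open>g x\<close> lies.\<close>
  have g_slope: "g x \<le> \<Lambda> (i + 1) * slope n \<and> slope n \<le> \<Lambda> (i + 1) * g x"
    if "\<bar>x - of_int n\<bar> \<le> real i" for x i n
  proof -
    define k where "k = \<lfloor>x\<rfloor>"
    have k: "\<bar>k - n\<bar> \<le> int (i + 1)" "\<bar>k + 1 - n\<bar> \<le> int (i + 1)" "of_int k \<le> x" "x \<le> of_int k + 1"
      using that unfolding k_def by linarith+
    have *: "slope m \<le> \<Lambda> (i + 1) * slope n" "slope n \<le> \<Lambda> (i + 1) * slope m" if "m = k \<or> m = k + 1" for m
      using slope_shift[of "m - n" "i + 1" n] slope_shift[of "n - m" "i + 1" m] k that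
      by (auto simp: abs_minus_commute)
    have "slope n \<le> \<Lambda> (i + 1) * min (slope k) (slope (k + 1))"
      using *[of k] *[of "k + 1"] by (auto simp: min_def)
    also have "\<dots> \<le> \<Lambda> (i + 1) * g x"
      using g_between[OF k(3,4)] \<Lambda>0[of "i + 1"] by (intro mult_left_mono) auto
    finally show ?thesis
      using *[of k] *[of "k + 1"] g_between[OF k(3,4)] by linarith
  qed
  have G_mono: "G x \<le> G y" if "x \<le> y" for x y
    by (rule DERIV_nonneg_imp_nondecreasing[OF that]) (use G g_pos less_imp_le in blast)
  have mvt: "\<exists>\<xi>. min x y \<le> \<xi> \<and> \<xi> \<le> max x y \<and> \<bar>G y - G x\<bar> = \<bar>y - x\<bar> * g \<xi>" for x y
  proof -
    have *: "\<exists>\<xi>. x \<le> \<xi> \<and> \<xi> \<le> y \<and> \<bar>G y - G x\<bar> = \<bar>y - x\<bar> * g \<xi>" if xy: "x < y" for x y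
    proof -
      obtain z where "x < z" "z < y" "G y - G x = (y - x) * g z"
        using MVT2[OF xy, of G g] G by blast
      then show ?thesis using g_pos[of z] by (intro exI[of _ z]) (auto simp: abs_mult)
    qed
    show ?thesis
    proof (cases x y rule: linorder_cases)
      case less
      then show ?thesis using *[OF less] by auto
    next
      case equal
      then show ?thesis by auto
    next
      case greater
      then show ?thesis using *[OF greater] by (auto simp: abs_minus_commute)
    qed
  qed
  have c_ge: "(\<Lambda> M)\<^sup>2 * \<eta> 4 \<le> c" "(\<Lambda> (M + 3))\<^sup>2 \<le> c" by (auto simp: c_def)
  have doubling: "\<bar>G (x + y) - G x\<bar> \<le> c * \<bar>G x - G (x - y)\<bar>" for x y
  \<comment> \<open>For short y the mean value theorem reduces doubling to comparing
    \<open>g\<close> at two points within M + 2 of the integer part of x; passing through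
    \<open>slope n\<close> costs the constant twice. For long y integer points are compared by
    \<open>avg_coarse\<close>.\<close>
  proof (cases "\<bar>y\<bar> < real M + 1")
    case True
    define n where "n = \<lfloor>x\<rfloor>"
    have n: "of_int n \<le> x" "x < of_int n + 1" by (auto simp: n_def)
    obtain \<xi> where \<xi>: "min x (x + y) \<le> \<xi>" "\<xi> \<le> max x (x + y)" "\<bar>G (x + y) - G x\<bar> = \<bar>y\<bar> * g \<xi>"
      using mvt[of x "x + y"] by auto
    obtain \<zeta> where \<zeta>: "min (x - y) x \<le> \<zeta>" "\<zeta> \<le> max (x - y) x" "\<bar>G x - G (x - y)\<bar> = \<bar>y\<bar> * g \<zeta>"
      using mvt[of "x - y" x] by auto
    have "\<bar>\<xi> - of_int n\<bar> \<le> real (M + 2)" "\<bar>\<zeta> - of_int n\<bar> \<le> real (M + 2)"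
      using \<xi>(1,2) \<zeta>(1,2) n True by (auto simp: min_def max_def split: if_splits)
    then have "g \<xi> \<le> \<Lambda> (M + 3) * slope n" "slope n \<le> \<Lambda> (M + 3) * g \<zeta>"
      using g_slope[of \<xi> n "M + 2"] g_slope[of \<zeta> n "M + 2"] by (simp_all add: numeral_eq_Suc)
    then have "g \<xi> \<le> \<Lambda> (M + 3) * (\<Lambda> (M + 3) * g \<zeta>)"
      using \<Lambda>0[of "M + 3"] by (meson mult_left_mono less_imp_le order_trans)
    also have "\<dots> \<le> c * g \<zeta>"
      using mult_right_mono[OF c_ge(2) less_imp_le[OF g_pos[of \<zeta>]]] by (simp add: power2_eq_square mult_ac)
    finally show ?thesis
      unfolding \<xi>(3) \<zeta>(3) using mult_left_mono[of "g \<xi>" "c * g \<zeta>" "\<bar>y\<bar>"] by (simp add: mult_ac)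
  next
    case False
    define n where "n = \<lfloor>x\<rfloor>"
    have n: "of_int n \<le> x" "x < of_int n + 1" by (auto simp: n_def)
    define k where "k = \<lfloor>\<bar>y\<bar>\<rfloor>"
    have k: "of_int k \<le> \<bar>y\<bar>" "\<bar>y\<bar> < of_int k + 1" "int M + 1 \<le> k"
      using False unfolding k_def by linarith+
    have coarse: "\<bar>G (of_int (p + j)) - G (of_int p)\<bar> \<le> c * \<bar>G (of_int (p + l)) - G (of_int p)\<bar>"
      if "int M \<le> \<bar>l\<bar>" "\<bar>j\<bar> \<le> 4 * \<bar>l\<bar>" for p j l
      using avg_coarse[OF that, of p] mult_right_mono[OF c_ge(1) abs_ge_zero[of "avg (p + l) - avg p"]]
      unfolding Gavg by linarith
    have c0: "0 \<le> c" using c_ge(2) by (meson zero_le_power2 order_trans)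
    show ?thesis
    proof (cases "0 \<le> y")
      case True
      \<comment> \<open>The interval between x and x + y is enlarged to integer ends and the one
        between x - y and x is shrunk, with common end n; their lengths become k + 2 and k - 1. For
        negative y the common end is n + 1.\<close>
      have "\<bar>G (x + y) - G x\<bar> \<le> \<bar>G (of_int (n + (k + 2))) - G (of_int n)\<bar>"
        using G_mono[of x "x + y"] G_mono[of "x + y" "of_int (n + (k + 2))"] G_mono[of "of_int n" x] n k True by simp
      also have "\<dots> \<le> c * \<bar>G (of_int (n + (1 - k))) - G (of_int n)\<bar>"
        by (rule coarse) (use k M in auto)
      also have "\<dots> \<le> c * \<bar>G x - G (x - y)\<bar>"
        using G_mono[of "of_int n" x] G_mono[of "x - y" "of_int (n + (1 - k))"]
          G_mono[of "of_int (n + (1 - k))" "of_int n"] n k True M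
        by (intro mult_left_mono c0) simp
      finally show ?thesis .
    next
      case False
      have "\<bar>G (x + y) - G x\<bar> \<le> \<bar>G (of_int (n + 1 + (- k - 2))) - G (of_int (n + 1))\<bar>"
        using G_mono[of "x + y" x] G_mono[of "of_int (n + 1 + (- k - 2))" "x + y"] G_mono[of x "of_int (n + 1)"] n k False by simp
      also have "\<dots> \<le> c * \<bar>G (of_int (n + 1 + (k - 1))) - G (of_int (n + 1))\<bar>"
        by (rule coarse) (use k M in auto)
      also have "\<dots> \<le> c * \<bar>G x - G (x - y)\<bar>"
        using G_mono[of x "of_int (n + 1)"] G_mono[of "of_int (n + 1 + (k - 1))" "x - y"]
          G_mono[of "of_int (n + 1)" "of_int (n + 1 + (k - 1))"] n k False M
        by (intro mult_left_mono c0) simp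
      finally show ?thesis .
    qed
  qed
  have "\<exists>s. \<bar>s - of_int n\<bar> \<le> real D \<and> G s = r n" for n
  proof -
    have D0: "0 < D" using D(1) M by simp
    \<comment> \<open>The values averaged in \<open>avg n\<close> are within M of n, so they differ
      from \<open>r n\<close> by at most \<eta>(M/D) times a step of length D, which by the choice
      of D is at most the increment of \<open>avg\<close>. Hence \<open>r n\<close> lies between the
      values of G at n - D and n + D.\<close>
    have near: "\<bar>avg n - r n\<bar> \<le> \<bar>avg (n + l) - avg n\<bar>" if l: "\<bar>l\<bar> = int D" for l
    proof (rule abs_avg_diff_le)
      fix i assume "i \<le> M"
      moreover have "\<bar>real_of_int l\<bar> = real D" using l by linarith
      ultimately have "real i \<le> real M / real D * \<bar>real_of_int l\<bar>" using D0 by simp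
      then have "\<bar>r n - r (n + int i)\<bar> \<le> \<eta> (real M / real D) * \<bar>r n - r (n + l)\<bar>"
        using l D0 by (intro qs_bound) auto
      also have "\<dots> \<le> \<eta> (real M / real D) * (\<Lambda> M * \<bar>avg (n + l) - avg n\<bar>)"
        using avg_lower[of l n] l D(1)
        by (intro mult_left_mono \<eta>_nonneg) (auto simp: abs_minus_commute)
      also have "\<dots> \<le> 1 * \<bar>avg (n + l) - avg n\<bar>"
        unfolding mult.assoc[symmetric] by (intro mult_right_mono D) auto
      finally show "\<bar>r (n + int i) - r n\<bar> \<le> \<bar>avg (n + l) - avg n\<bar>" by (simp add: abs_minus_commute)
    qed
    have "avg (n - int D) \<le> avg n" "avg n \<le> avg (n + int D)"
      unfolding Gavg[symmetric] by (simp_all add: G_mono)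
    then have "G (of_int (n - int D)) \<le> r n" "r n \<le> G (of_int (n + int D))"
      unfolding Gavg using near[of "int D"] near[of "- int D"] by simp_all
    then obtain s where "of_int (n - int D) \<le> s" "s \<le> of_int (n + int D)" "G s = r n"
      using IVT[of G "of_int (n - int D)" "r n" "of_int (n + int D)"] DERIV_isCont[OF G] by auto
    then show ?thesis by (intro exI[of _ s]) auto
  qed
  then obtain \<sigma> where \<sigma>: "\<And>n. \<bar>\<sigma> n - of_int n\<bar> \<le> real D" "\<And>n. G (\<sigma> n) = r n" by metis
  have sep: "1 / (\<Lambda> (D + 2) * \<eta> (real M)) \<le> \<bar>\<sigma> m - \<sigma> n\<bar>" if "m \<noteq> n" for m n
  proof -
    have \<eta>M: "1 \<le> \<eta> (real M)" using M by (intro \<eta>_ge_1) simp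
    have pos: "1 \<le> \<Lambda> (D + 2) * \<eta> (real M)"
      using mult_mono[of 1 "\<Lambda> (D + 2)" 1 "\<eta> (real M)"] \<Lambda>_ge_2[of "D + 2"] \<eta>M by simp
    show ?thesis
    \<comment> \<open>The bound is at most 1, so only distances below 1 matter. There |r m - r n| is
      at most the distance times a multiple of \<open>slope n\<close>, while \<open>slope n\<close>
      is at most \<eta>(M) |r m - r n|; the factor |r m - r n| cancels.\<close>
    proof (cases "\<bar>\<sigma> m - \<sigma> n\<bar> < 1")
      case True
      obtain \<xi> where \<xi>: "min (\<sigma> n) (\<sigma> m) \<le> \<xi>" "\<xi> \<le> max (\<sigma> n) (\<sigma> m)"
        "\<bar>G (\<sigma> m) - G (\<sigma> n)\<bar> = \<bar>\<sigma> m - \<sigma> n\<bar> * g \<xi>"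
        using mvt by blast
      have "\<bar>\<xi> - of_int n\<bar> \<le> real (D + 1)"
        using \<xi>(1,2) \<sigma>(1)[of n] True by (auto simp: min_def max_def split: if_splits)
      then have g\<xi>: "g \<xi> \<le> \<Lambda> (D + 2) * slope n"
        using g_slope[of \<xi> n "D + 1"] by (simp add: numeral_eq_Suc)
      have "\<bar>r n - r (n + int M)\<bar> \<le> \<eta> (real M) * \<bar>r n - r m\<bar>"
      proof (rule qs_bound)
        have "1 \<le> real_of_int \<bar>n - m\<bar>" using that by linarith
        then show "\<bar>real_of_int (n - (n + int M))\<bar> \<le> real M * \<bar>of_int (n - m)\<bar>"
          using mult_left_mono[of 1 "real_of_int \<bar>n - m\<bar>" "real M"] by simp
      qed (use that in simp)
      moreover have "slope n \<le> \<bar>r n - r (n + int M)\<bar>"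
      proof -
        have "slope n \<le> (r (n + int M) - r n) / 1"
          unfolding slope_def using M inc[of n "n + int M"] by (intro divide_left_mono) auto
        then show ?thesis by simp
      qed
      ultimately have sl: "slope n \<le> \<eta> (real M) * \<bar>r m - r n\<bar>" by (simp add: abs_minus_commute)
      have "\<bar>r m - r n\<bar> = \<bar>\<sigma> m - \<sigma> n\<bar> * g \<xi>" using \<xi>(3) by (simp add: \<sigma>(2))
      also have "\<dots> \<le> \<bar>\<sigma> m - \<sigma> n\<bar> * (\<Lambda> (D + 2) * slope n)"
        using g\<xi> by (intro mult_left_mono) auto
      also have "\<dots> \<le> \<bar>\<sigma> m - \<sigma> n\<bar> * (\<Lambda> (D + 2) * (\<eta> (real M) * \<bar>r m - r n\<bar>))"
        using sl less_imp_le[OF \<Lambda>0] by (intro mult_left_mono) auto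
      finally have "1 * \<bar>r m - r n\<bar> \<le> (\<bar>\<sigma> m - \<sigma> n\<bar> * (\<Lambda> (D + 2) * \<eta> (real M))) * \<bar>r m - r n\<bar>"
        by (simp add: mult_ac)
      moreover have "0 < \<bar>r m - r n\<bar>" using that by simp
      ultimately have "1 \<le> \<bar>\<sigma> m - \<sigma> n\<bar> * (\<Lambda> (D + 2) * \<eta> (real M))"
        by (simp only: mult_le_cancel_right_pos)
      then show ?thesis using pos by (simp add: divide_le_eq)
    next
      case False
      have "1 / (\<Lambda> (D + 2) * \<eta> (real M)) \<le> 1" using pos by simp
      then show ?thesis using False by linarith
    qed
  qed
  show ?thesis
    by (rule that[OF G cont_g g_pos doubling \<sigma>(2,1) sep])
qed

end

section \<open>The choice of constants and the theorem\<close>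

lemma C1_qc_mono:
  assumes "C1_qc K F" "K \<le> K'"
  shows "C1_qc K' F"
proof -
  have "hs_norm2 L \<le> K' * jac_det L" if "0 < jac_det L" "hs_norm2 L \<le> K * jac_det L" for L
    using that mult_right_mono[OF assms(2) less_imp_le[OF that(1)]] by linarith
  then show ?thesis using assms(1) unfolding C1_qc_def by blast
qed

lemma quasisymmetry_gauge:
  fixes \<eta> :: "real \<Rightarrow> real"
  assumes "homeomorphism {0..} {0..} \<eta> \<theta>"
  shows "\<And>s t. 0 \<le> s \<Longrightarrow> s \<le> t \<Longrightarrow> \<eta> s \<le> \<eta> t" and "\<And>\<epsilon>. 0 < \<epsilon> \<Longrightarrow> \<exists>s>0. \<eta> s \<le> \<epsilon>"
proof -
  have cont: "continuous_on {0..} \<eta>" and img: "\<eta> ` {0..} = {0..}" and inj: "inj_on \<eta> {0..}"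
    using assms by (auto simp: homeomorphism_def intro: inj_on_inverseI)
  \<comment> \<open>A decreasing map would have its maximum at 0 and miss \<eta>(0) + 1.\<close>
  have "\<not> strict_antimono_on {0..} \<eta>"
  proof
    assume anti: "strict_antimono_on {0..} \<eta>"
    have "0 \<le> \<eta> 0" using img by auto
    then have "\<eta> 0 + 1 \<in> \<eta> ` {0..}" by (simp add: img)
    then obtain t where "0 \<le> t" "\<eta> t = \<eta> 0 + 1" by auto
    then show False using monotone_onD[OF anti, of 0 t] by (cases "t = 0") auto
  qed
  then have smono: "strict_mono_on {0..} \<eta>"
    using injective_eq_monotone_map[of "{0..}" \<eta>] cont inj by (auto simp: is_interval_ci)
  show mono: "\<eta> s \<le> \<eta> t" if "0 \<le> s" "s \<le> t" for s t
    using monotone_onD[OF smono, of s t] that by (cases "s = t") auto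
  have \<eta>0: "\<eta> 0 = 0"
  proof -
    have "0 \<in> \<eta> ` {0..}" by (simp add: img)
    then obtain t where "0 \<le> t" "\<eta> t = 0" by auto
    moreover have "0 \<le> \<eta> 0" using img by auto
    ultimately show ?thesis using mono[of 0 t] by simp
  qed
  show "\<exists>s>0. \<eta> s \<le> \<epsilon>" if "0 < \<epsilon>" for \<epsilon>
  proof -
    have "\<epsilon> \<in> \<eta> ` {0..}" using that by (simp add: img)
    then obtain s where "0 \<le> s" "\<eta> s = \<epsilon>" by auto
    then show ?thesis using \<eta>0 that by (intro exI[of _ s]) (auto simp: less_le)
  qed
qed

theorem theorem1:
  fixes \<eta> :: "real \<Rightarrow> real"
  assumes "\<exists>\<theta>. homeomorphism {0..} {0..} \<eta> \<theta>"
  shows "\<exists>K::real. K \<ge> 1 \<and>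
           (\<forall>f :: complex \<Rightarrow> complex. quasisymmetric_on \<eta> \<int> f \<and> f ` \<int> \<subseteq> \<real> \<longrightarrow>
              (\<exists>F :: complex \<Rightarrow> complex. quasiconformal_on K UNIV F \<and> (\<forall>n\<in>\<int>. F n = f n)))"
proof -
  obtain \<theta> where \<theta>: "homeomorphism {0..} {0..} \<eta> \<theta>" using assms by blast
  note mono = quasisymmetry_gauge(1)[OF \<theta>] and small = quasisymmetry_gauge(2)[OF \<theta>]
  have small_nat: "\<exists>m\<ge>k. 1 \<le> m \<and> \<eta> (t / real m) \<le> \<epsilon>" if "0 < \<epsilon>" "0 \<le> t" for \<epsilon> t and k :: nat
  proof -
    obtain s where s: "s > 0" "\<eta> s \<le> \<epsilon>" using small[OF \<open>0 < \<epsilon>\<close>] by blast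
    obtain m where m: "t / s < real m" using reals_Archimedean2 by blast
    define m' where "m' = max m (max k 1)"
    have "real m \<le> real m'" "0 < real m'" unfolding m'_def by auto
    moreover have "t < s * real m" using s m by (simp add: field_simps)
    moreover have "s * real m \<le> s * real m'" using s by (simp add: m'_def)
    ultimately have "t / real m' \<le> s" by (simp only: divide_le_eq) simp
    then have "\<eta> (t / real m') \<le> \<epsilon>" using mono[of "t / real m'" s] s \<open>0 \<le> t\<close> by simp
    then show ?thesis by (intro exI[of _ m']) (auto simp: m'_def)
  qed
  \<comment> \<open>Any bound below 1 serves for \<open>coarsely_monotone\<close>. From here to
    \<open>K0\<close> every constant is chosen from \<eta> alone, before a sequence is
    fixed.\<close>
  obtain M where M: "1 \<le> M" "\<eta> (1 / real M) \<le> 1 / 2"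
    using small_nat[of "1/2" 1 0] by auto
  obtain D where D: "M \<le> D" "\<eta> (real M / real D) \<le> 1 / max 1 (shift_const \<eta> M)"
    using small_nat[of "1 / max 1 (shift_const \<eta> M)" "real M" M] by (auto simp: less_max_iff_disj)
  define c where "c = max ((shift_const \<eta> M)\<^sup>2 * \<eta> 4) ((shift_const \<eta> (M + 3))\<^sup>2)"
  \<comment> \<open>The maxima with 1 are vacuous as soon as some \<open>\<eta>\<close>-quasisymmetric sequence exists.\<close>
  define \<delta> where "\<delta> = 1 / max 1 (shift_const \<eta> (D + 2) * \<eta> (real M))"
  have "0 < \<delta>" by (simp add: \<delta>_def)
  then obtain L where L: "\<And>\<sigma> :: int \<Rightarrow> real. (\<And>n. \<bar>\<sigma> n - of_int n\<bar> \<le> real D) \<Longrightarrow>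
      (\<And>m n. m \<noteq> n \<Longrightarrow> \<delta> \<le> \<bar>\<sigma> m - \<sigma> n\<bar>) \<Longrightarrow>
      \<exists>S. C1_qc L S \<and> (\<forall>n. S (of_int n) = of_real (\<sigma> n))"
    using C1_qc_bounded_displacement[of "real D" \<delta>] by (metis of_nat_0_le_iff)
  define K0 where "K0 = 4 * c * (1 + c) * L"
  have increasing: "\<exists>F. C1_qc K0 F \<and> (\<forall>n. F (of_int n) = of_real (r n))" if "qs_seq_increasing \<eta> r M" for r
  proof -
    interpret qs_seq_increasing \<eta> r M by fact
    have "0 < shift_const \<eta> M" using \<Lambda>_ge_2[of M] by simp
    then have "\<eta> (real M / real D) * \<Lambda> M \<le> 1 / max 1 (shift_const \<eta> M) * \<Lambda> M"
      using D(2) by (intro mult_right_mono) auto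
    also have "\<dots> \<le> 1" by (simp add: divide_le_eq)
    finally have D': "\<eta> (real M / real D) * \<Lambda> M \<le> 1" .
    obtain G g \<sigma> where G: "\<And>x. (G has_real_derivative g x) (at x)" "continuous_on UNIV g" "\<And>x. 0 < g x"
      "\<And>x y. \<bar>G (x + y) - G x\<bar> \<le> c * \<bar>G x - G (x - y)\<bar>"
      and \<sigma>: "\<And>n. G (\<sigma> n) = r n" "\<And>n. \<bar>\<sigma> n - of_int n\<bar> \<le> real D"
      "\<And>m n. m \<noteq> n \<Longrightarrow> 1 / (\<Lambda> (D + 2) * \<eta> (real M)) \<le> \<bar>\<sigma> m - \<sigma> n\<bar>"
      using doubling_interpolation[OF D(1) D'] unfolding c_def by blast
    have "1 \<le> \<Lambda> (D + 2) * \<eta> (real M)"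
      using mult_mono[of 1 "\<Lambda> (D + 2)" 1 "\<eta> (real M)"] \<Lambda>_ge_2[of "D + 2"] \<eta>_ge_1[of "real M"] M by simp
    then have "\<delta> \<le> \<bar>\<sigma> m - \<sigma> n\<bar>" if "m \<noteq> n" for m n
      using \<sigma>(3)[OF that] by (simp add: \<delta>_def max_def)
    then obtain S where S: "C1_qc L S" "\<And>n. S (of_int n) = of_real (\<sigma> n)"
      using L[of \<sigma>] \<sigma>(2) by blast
    obtain \<Phi> where \<Phi>: "C1_qc (4 * c * (1 + c)) \<Phi>" "\<And>x. \<Phi> (of_real x) = of_real (G x)"
      using C1_qc_Beurling_Ahlfors[OF G] by blast
    show ?thesis
      using C1_qc_comp[OF \<Phi>(1) S(1)] by (intro exI[of _ "\<Phi> \<circ> S"]) (simp add: K0_def S(2) \<Phi>(2) \<sigma>(1))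
  qed
  \<comment> \<open>\<open>2 * K0\<close> is for decreasing sequences, negated by
    \<open>C1_qc_uminus\<close>. \<open>K0\<close> is listed too because its sign is not known at
    this point.\<close>
  define K where "K = max 1 (max K0 (2 * K0))"
  have "\<exists>F. quasiconformal_on K UNIV F \<and> (\<forall>n\<in>\<int>. F n = f n)"
    if f: "quasisymmetric_on \<eta> \<int> f" "f ` \<int> \<subseteq> \<real>" for f
  proof -
    define r where "r n = Re (f (of_int n))" for n :: int
    have fr: "f (of_int n) = of_real (r n)" for n
    proof -
      have "f (of_int n) \<in> \<real>" using f(2) by auto
      then show ?thesis by (simp add: r_def)
    qed
    have seq: "qs_seq \<eta> r"
    proof
      show "\<eta> s \<le> \<eta> t" if "0 \<le> s" "s \<le> t" for s t by (rule mono[OF that])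
      have inj: "inj_on f \<int>" using f(1) by (simp add: quasisymmetric_on_def)
      show inj_r: "inj r"
      proof (rule injI)
        fix m n assume "r m = r n"
        then have "f (of_int m) = f (of_int n)" by (simp add: fr)
        then show "m = n" using inj_onD[OF inj] by (metis Ints_of_int of_int_eq_iff)
      qed
      fix x y z :: int assume xz: "x \<noteq> z"
      then have "r x - r z \<noteq> 0" using inj_r by (auto dest: injD)
      have "cmod ((f (of_int x) - f (of_int y)) / (f (of_int x) - f (of_int z)))
          \<le> \<eta> (cmod ((of_int x - of_int y) / (of_int x - of_int z)))"
        using f(1) xz unfolding quasisymmetric_on_def by (metis Ints_of_int of_int_eq_iff)
      then have "\<bar>r x - r y\<bar> / \<bar>r x - r z\<bar> \<le> \<eta> (\<bar>of_int (x - y)\<bar> / \<bar>of_int (x - z)\<bar>)"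
        by (simp add: fr norm_divide flip: of_real_diff of_int_diff)
      then show "\<bar>r x - r y\<bar> \<le> \<eta> (\<bar>of_int (x - y)\<bar> / \<bar>of_int (x - z)\<bar>) * \<bar>r x - r z\<bar>"
        using \<open>r x - r z \<noteq> 0\<close> by (simp add: divide_le_eq)
    qed
    then interpret qs_seq \<eta> r .
    have "(\<forall>n m. n + int M \<le> m \<longrightarrow> r n < r m) \<or> (\<forall>n m. n + int M \<le> m \<longrightarrow> r m < r n)"
      by (rule coarsely_monotone) (use M in simp_all)
    then have "\<exists>F. C1_qc K F \<and> (\<forall>n. F (of_int n) = of_real (r n))"
    proof
      assume "\<forall>n m. n + int M \<le> m \<longrightarrow> r n < r m"
      then have "qs_seq_increasing \<eta> r M"
        using seq M by (simp add: qs_seq_increasing_def qs_seq_increasing_axioms_def)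
      then obtain F where "C1_qc K0 F" "\<And>n. F (of_int n) = of_real (r n)" using increasing by blast
      moreover have "K0 \<le> K" by (simp add: K_def)
      ultimately show ?thesis using C1_qc_mono by blast
    next
      assume dec: "\<forall>n m. n + int M \<le> m \<longrightarrow> r m < r n"
      have "qs_seq \<eta> (\<lambda>n. - r n)"
        using seq by (simp add: qs_seq_def inj_def abs_minus_commute)
      then have "qs_seq_increasing \<eta> (\<lambda>n. - r n) M"
        using dec M by (simp add: qs_seq_increasing_def qs_seq_increasing_axioms_def)
      then obtain F where F: "C1_qc K0 F" "\<And>n. F (of_int n) = of_real (- r n)" using increasing by blast
      have "C1_qc K (uminus \<circ> F)"
        by (rule C1_qc_mono[OF C1_qc_comp[OF C1_qc_uminus F(1)]]) (simp add: K_def)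
      then show ?thesis using F(2) by (intro exI[of _ "uminus \<circ> F"]) simp
    qed
    then obtain F where F: "C1_qc K F" "\<And>n. F (of_int n) = of_real (r n)" by blast
    have "quasiconformal_on K UNIV F"
      by (rule quasiconformal_on_UNIV_if_C1_qc[OF F(1)]) (simp add: K_def)
    then show ?thesis using F(2) fr by (metis Ints_cases)
  qed
  moreover have "1 \<le> K" by (simp add: K_def)
  ultimately show ?thesis by blast
qed

end
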